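(* Let $U\subset\mathbb{R}^2$ be compact and let $\phi:U\to[0,\infty)$ be the restriction of a smooth function defined on an open neighbourhood of $U$ whose Hessian is positive definite everywhere (so that the graph $S=\{(\xi,\phi(\xi)):\xi\in U\}$ is a smooth convex surface with everywhere nonvanishing Gaussian curvature). For $g\in L^2(U)$ and $(x,s)\in\mathbb{R}^2\times\mathbb{R}$ define the extension operator $$\mathcal{E}g(x,s)=\int_Ug(\xi)e^{i(s\phi(\xi)+x\cdot\xi)}\,\mathrm{d}\xi,$$ and for $t\ge0$ let $g_t(\xi)=e^{-t\phi(\xi)}g(\xi)$. Then there exists a constant $c<\infty$, depending only on $U$ and $\phi$, such that for every $g\in L^2(U)$ the function $Q:(0,\infty)\to\mathbb{R}$, $$Q(t)=c\,\|g_t\|_{L^2(U)}^4-\|\mathcal{E}g_t\|_{L^4_{x,s}(\mathbb{R}^2\times\mathbb{R})}^4,$$ is completely monotone (decreasing).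
   Context: A function $Q:(0,\infty)\to\mathbb{R}$ is completely monotone (decreasing) if it is infinitely differentiable and $(-1)^kQ^{(k)}(t)\ge0$ for all $t>0$ and all positive integers $k$. *)

theory Defs
  imports "HOL-Analysis.Analysis"
begin

fun iter_pderiv :: "('a::euclidean_space \<Rightarrow> real) \<Rightarrow> 'a list \<Rightarrow> 'a \<Rightarrow> real" where
  "iter_pderiv f [] = f"
| "iter_pderiv f (v # vs) = (\<lambda>x. frechet_derivative (iter_pderiv f vs) (at x) v)"

definition smooth_on :: "'a::euclidean_space set \<Rightarrow> ('a \<Rightarrow> real) \<Rightarrow> bool" where
  "smooth_on V f \<longleftrightarrow> (\<forall>vs. set vs \<subseteq> Basis \<longrightarrow> iter_pderiv f vs differentiable_on V)"

definition hessian :: "('a::euclidean_space \<Rightarrow> real) \<Rightarrow> 'a \<Rightarrow> 'a \<Rightarrow> 'a \<Rightarrow> real" where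
  "hessian f x i j = iter_pderiv f [i, j] x"

definition hessian_posdef :: "('a::euclidean_space \<Rightarrow> real) \<Rightarrow> 'a \<Rightarrow> bool" where
  "hessian_posdef f x \<longleftrightarrow>
     (\<forall>v. v \<noteq> 0 \<longrightarrow> (\<Sum>i\<in>Basis. \<Sum>j\<in>Basis. (v \<bullet> i) * (v \<bullet> j) * hessian f x i j) > 0)"

definition completely_monotone :: "(real \<Rightarrow> real) \<Rightarrow> bool" where
  "completely_monotone Q \<longleftrightarrow>
     (\<forall>k. \<forall>t>0. (deriv ^^ k) Q differentiable (at t)
            \<and> (k \<ge> 1 \<longrightarrow> (-1) ^ k * (deriv ^^ k) Q t \<ge> 0))"

definition ext_op :: "(real^2) set \<Rightarrow> (real^2 \<Rightarrow> real) \<Rightarrow> (real^2 \<Rightarrow> complex)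
                      \<Rightarrow> ((real^2) \<times> real) \<Rightarrow> complex" where
  "ext_op U \<phi> g = (\<lambda>(x, s). LINT \<xi>:U|lebesgue. g \<xi> * cis (s * \<phi> \<xi> + x \<bullet> \<xi>))"

end

theory Submission
  imports Defs "HOL-Probability.Characteristic_Functions"
begin

text \<open>
  Let \<open>\<Psi> (\<xi>, \<eta>) = (\<xi> + \<eta>, \<phi> \<xi> + \<phi> \<eta>)\<close>. The square of the extension of \<open>g\<^sub>t\<close> is the Fourier transform of the
  push-forward under \<open>\<Psi>\<close> of \<open>g(\<xi>) g(\<eta>)\<close>, weighted by \<open>exp (- t \<tau>)\<close> in the last coordinate \<open>\<tau>\<close>.
  For fixed \<open>\<zeta>\<close> the function \<open>\<xi> \<mapsto> \<phi> \<xi> + \<phi> (\<zeta> - \<xi>)\<close> is strongly convex on finitely many convex pieces, and in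
  the plane the layers \<open>a < F \<le> b\<close> of a strongly convex \<open>F\<close> have area at most a constant times \<open>b - a\<close>.
  Hence \<open>\<Psi>\<close> pushes Lebesgue measure on \<open>U \<times> U\<close> to a measure with density at most \<open>C\<close>. By Cauchy--Schwarz the
  density \<open>f\<close> of the push-forward of \<open>g \<otimes> g\<close> and the density \<open>m\<close> of that of \<open>|g \<otimes> g|\<^sup>2\<close> satisfy \<open>|f|\<^sup>2 \<le> C m\<close>.
  With \<open>c = (2 \<pi>)\<^sup>3 C\<close> Plancherel's theorem turns \<open>Q(t)\<close> into the integral of
  \<open>exp (- 2 t \<tau>) (2 \<pi>)\<^sup>3 (C m - |f|\<^sup>2)\<close>, the Laplace transform of a finite positive measure.
\<close>

section \<open>Plancherel's theorem\<close>

text \<open>The parameter \<open>t\<close> enters \<open>g\<^sub>t(\<xi>) g\<^sub>t(\<eta>)\<close>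
  only through \<open>exp (- t (\<phi> \<xi> + \<phi> \<eta>))\<close>, a function of the image
  point under \<open>\<Psi>\<close>. Hence \<open>f\<close> and \<open>m\<close> do not depend on
  \<open>t\<close>, and one pointwise inequality serves all \<open>t\<close> and all derivatives;
  \<open>\<phi> \<ge> 0\<close> on \<open>U\<close> then fixes the sign of every derivative. The
  constant is purely geometric: quadratic growth gives a sublevel set of height \<open>s\<close> an
  area of order \<open>s\<close> exactly in dimension two, and so bounded layers. Two obstacles
  shape the argument. \<open>U\<close> may fail to be convex, so convexity is used only on balls
  inside \<open>V\<close>, taken in pairs, at the price of a factor counting the pairs. And
  Cauchy--Schwarz on the fibres of \<open>\<Psi>\<close> would call for a coarea formula; instead
  the push-forward is only shown to be dominated by \<open>C\<close> times Lebesgue measure, and the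
  inequality comes from integrating \<open>|w - g(\<xi>) g(\<eta>)|^2 \<ge> 0\<close> over
  preimages, for constants \<open>w\<close>.\<close>

lemma integrable_lborel_translate:
  fixes f :: "'a::euclidean_space \<Rightarrow> 'b::{banach,second_countable_topology}"
  assumes "integrable lborel f"
  shows "integrable lborel (\<lambda>x. f (x + h))"
proof -
  have "integrable (distr lborel borel ((+) h)) f"
    using assms by (simp add: lborel_distr_plus)
  then have "integrable lborel (\<lambda>x. f (h + x))"
    by (subst (asm) integrable_distr_eq) (use assms in auto)
  then show ?thesis
    by (simp add: add.commute)
qed

lemma integral_lborel_translate:
  fixes f :: "'a::euclidean_space \<Rightarrow> 'b::{banach,second_countable_topology}"
  assumes [measurable]: "f \<in> borel_measurable borel"
  shows "(\<integral>x. f (x + h) \<partial>lborel) = (\<integral>x. f x \<partial>lborel)"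
proof -
  have "(\<integral>x. f x \<partial>lborel) = (\<integral>x. f x \<partial>distr lborel borel ((+) h))"
    by (simp add: lborel_distr_plus)
  also have "\<dots> = (\<integral>x. f (h + x) \<partial>lborel)"
    by (subst integral_distr) auto
  finally show ?thesis
    by (simp add: add.commute)
qed

lemma integral_lborel_scaleR:
  fixes f :: "'a::euclidean_space \<Rightarrow> 'b::{banach,second_countable_topology}"
  assumes [measurable]: "f \<in> borel_measurable borel" and c: "0 < c"
  shows "(\<integral>x. f x \<partial>lborel) = c ^ DIM('a) *\<^sub>R (\<integral>x. f (c *\<^sub>R x) \<partial>lborel)"
  using c by (subst lborel_affine[of c 0]) (simp_all add: integral_density integral_distr)

text \<open>Outer regularity replaces \<open>A\<close> by an open \<open>O'\<close> with
  \<open>O' - A\<close> small: a point of \<open>A\<close> moved by a small \<open>h n\<close> stays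
  in \<open>O'\<close>, so dominated convergence controls the overlap of \<open>A\<close> with the
  translate of \<open>O'\<close>.\<close>

lemma L1_translation_indicator:
  fixes A :: "'a::euclidean_space set"
  assumes A[measurable]: "A \<in> sets borel" and fin: "emeasure lborel A < \<infinity>" and h: "h \<longlonglongrightarrow> 0"
  shows "(\<lambda>n. \<integral>y. \<bar>indicator A (y + h n) - indicator A y\<bar> \<partial>lborel) \<longlonglongrightarrow> (0::real)"
proof (rule LIMSEQ_I)
  fix e :: real assume e: "0 < e"
  obtain O' where O': "open O'" "A \<subseteq> O'" "emeasure lborel (O' - A) < ennreal (e/8)"
    using outer_regular_lborel[OF A, of "e/8"] e by auto
  have [measurable]: "O' \<in> sets borel" using O' by simp
  have iA: "integrable lborel (indicator A :: 'a \<Rightarrow> real)"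
    using fin by (auto simp: integrable_indicator_iff)
  have OA: "emeasure lborel (O' - A) < \<infinity>"
    using O'(3) by (auto simp: top.not_eq_extremum less_top intro: order.strict_trans)
  have iOA: "integrable lborel (indicator (O' - A) :: 'a \<Rightarrow> real)"
    using OA by (auto simp: integrable_indicator_iff)
  have mOA: "measure lborel (O' - A) < e/8"
    using O'(3) OA e by (simp add: emeasure_eq_ennreal_measure less_top ennreal_less_iff)
  have lim: "(\<lambda>n. \<integral>y. indicator A y * indicator O' (y + h n) \<partial>lborel) \<longlonglongrightarrow> (\<integral>y. indicator A y \<partial>lborel :: real)"
  proof (rule integral_dominated_convergence[where w="indicator A"])
    show "AE y in lborel. (\<lambda>n. indicator A y * indicator O' (y + h n)) \<longlonglongrightarrow> (indicator A y :: real)"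
    proof (rule AE_I2)
      fix y :: 'a
      show "(\<lambda>n. indicator A y * indicator O' (y + h n)) \<longlonglongrightarrow> (indicator A y :: real)"
      proof (cases "y \<in> A")
        case True
        have "(\<lambda>n. y + h n) \<longlonglongrightarrow> y + 0" by (intro tendsto_intros h)
        then have "\<forall>\<^sub>F n in sequentially. y + h n \<in> O'"
          using O' True by (metis add.right_neutral subsetD topological_tendstoD)
        then have "\<forall>\<^sub>F n in sequentially. indicator A y * indicator O' (y + h n) = (indicator A y :: real)"
          by eventually_elim simp
        then show ?thesis by (simp add: tendsto_eventually)
      qed simp
    qed
  qed (use iA in \<open>auto split: split_indicator\<close>)
  then have "\<forall>\<^sub>F n in sequentially. (\<integral>y. indicator A y * indicator O' (y + h n) \<partial>lborel) > measure lborel A - e/8"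
    using e by (intro order_tendstoD(1)[of _ "measure lborel A"]) auto
  then have "\<forall>\<^sub>F n in sequentially. norm ((\<integral>y. \<bar>indicator A (y + h n) - indicator A y\<bar> \<partial>lborel) - 0 :: real) < e"
  proof eventually_elim
    case (elim n)
    have i1: "integrable lborel (\<lambda>y. indicator A (y + h n) :: real)"
      by (rule integrable_lborel_translate[OF iA])
    have i2: "integrable lborel (\<lambda>y. indicator (O' - A) (y + h n) :: real)"
      by (rule integrable_lborel_translate[OF iOA])
    have i3: "integrable lborel (\<lambda>y. indicator A y * indicator O' (y + h n) :: real)"
      by (rule Bochner_Integration.integrable_bound[OF iA]) (auto split: split_indicator)
    \<comment> \<open>For indicator values \<open>|a' - a| = a + a' - 2 a a'\<close>; using
      \<open>O'\<close> instead of \<open>A\<close> for \<open>a'\<close> in the product costs at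
      most twice the indicator of \<open>O' - A\<close>. The total stays below
      \<open>e / 4 + e / 4\<close>.\<close>
    have "(\<integral>y. \<bar>indicator A (y + h n) - indicator A y\<bar> \<partial>lborel :: real)
      \<le> (\<integral>y. indicator A (y + h n) + indicator A y - 2 * (indicator A y * indicator O' (y + h n))
            + 2 * indicator (O' - A) (y + h n) \<partial>lborel)"
      by (rule integral_mono) (use iA i1 i2 i3 O'(2) in \<open>auto split: split_indicator\<close>)
    also have "\<dots> = (\<integral>y. indicator A (y + h n) \<partial>lborel) + measure lborel A
        - 2 * (\<integral>y. indicator A y * indicator O' (y + h n) \<partial>lborel) + 2 * (\<integral>y. indicator (O' - A) (y + h n) \<partial>lborel)"
      using iA i1 i2 i3 by simp
    also have "\<dots> = 2 * measure lborel A
        - 2 * (\<integral>y. indicator A y * indicator O' (y + h n) \<partial>lborel) + 2 * measure lborel (O' - A)"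
      using integral_lborel_translate[of "indicator A :: 'a \<Rightarrow> real" "h n"]
        integral_lborel_translate[of "indicator (O' - A) :: 'a \<Rightarrow> real" "h n"] by simp
    also have "\<dots> < e"
      using elim mOA e by simp
    finally show ?case by (simp add: integral_nonneg)
  qed
  then show "\<exists>no. \<forall>n\<ge>no. norm ((\<integral>y. \<bar>indicator A (y + h n) - indicator A y\<bar> \<partial>lborel) - 0 :: real) < e"
    by (simp add: eventually_sequentially)
qed

text \<open>Induction over the construction of integrable functions: multiples of indicators, sums,
  dominated limits. In the limit case the translated error has the same integral as the error
  itself, so three terms below \<open>e / 3\<close> suffice.\<close>

lemma L1_translation_tendsto:
  fixes f :: "'a::euclidean_space \<Rightarrow> 'b::{banach,second_countable_topology}"
  assumes "integrable lborel f" and h: "h \<longlonglongrightarrow> 0"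
  shows "(\<lambda>n. \<integral>y. norm (f (y + h n) - f y) \<partial>lborel) \<longlonglongrightarrow> 0"
  using assms(1)
proof induct
  case (base A c)
  have "norm (indicator A (y + h n) *\<^sub>R c - indicator A y *\<^sub>R c) = \<bar>indicator A (y + h n) - indicator A y\<bar> * norm c"
    for y n by (simp flip: scaleR_diff_left)
  then show ?case
    using tendsto_mult_left_zero[OF L1_translation_indicator[OF _ _ h, of A], of "norm c"] base by simp
next
  case (add f g)
  have i: "integrable lborel (\<lambda>y. norm (f (y + h n) - f y))" "integrable lborel (\<lambda>y. norm (g (y + h n) - g y))"
     "integrable lborel (\<lambda>y. norm (f (y + h n) - f y + (g (y + h n) - g y)))" for n
    using add by (auto intro!: integrable_norm integrable_diff integrable_lborel_translate Bochner_Integration.integrable_add)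
  show ?case
  proof (rule real_tendsto_sandwich[OF _ _ tendsto_const tendsto_add_zero[OF add(2) add(4)]], goal_cases)
    case 2
    show ?case
      by (intro always_eventually allI)
         (subst Bochner_Integration.integral_add[symmetric], 
          auto intro!: integral_mono i Bochner_Integration.integrable_add simp: add_diff_add norm_triangle_ineq)
  qed (auto intro!: always_eventually integral_nonneg)
next
  case (lim f s)
  show ?case
  proof (rule LIMSEQ_I)
    fix e :: real assume e: "0 < e"
    \<comment> \<open>The approximants satisfy \<open>norm (s i y) \<le> 2 * norm (f y)\<close>,
      whence the factor 3 in the dominating function.\<close>
    have "(\<lambda>i. \<integral>y. norm (s i y - f y) \<partial>lborel) \<longlonglongrightarrow> integral\<^sup>L lborel (\<lambda>y::'a. 0::real)"
    proof (rule integral_dominated_convergence[where w="\<lambda>y. 3 * norm (f y)"])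
      show "AE y in lborel. (\<lambda>i. norm (s i y - f y)) \<longlonglongrightarrow> 0"
        using lim(3) by (auto intro!: AE_I2 tendsto_norm_zero LIM_zero)
      show "AE y in lborel. norm (norm (s i y - f y)) \<le> 3 * norm (f y)" for i
      proof (rule AE_I2)
        fix y show "norm (norm (s i y - f y)) \<le> 3 * norm (f y)"
          using norm_triangle_ineq4[of "s i y" "f y"] lim(4)[of y i] by simp
      qed
    qed (use lim in auto)
    then have "\<forall>\<^sub>F i in sequentially. (\<integral>y. norm (s i y - f y) \<partial>lborel) < e/3"
      using e by (intro order_tendstoD(2)) auto
    then obtain i where i: "(\<integral>y. norm (s i y - f y) \<partial>lborel) < e/3"
      by (auto simp: eventually_sequentially)
    have "\<forall>\<^sub>F n in sequentially. (\<integral>y. norm (s i (y + h n) - s i y) \<partial>lborel) < e/3"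
      using e by (intro order_tendstoD(2)[OF lim(2)]) auto
    then have "\<forall>\<^sub>F n in sequentially. norm ((\<integral>y. norm (f (y + h n) - f y) \<partial>lborel) - 0) < e"
    proof eventually_elim
      case (elim n)
      have d: "integrable lborel (\<lambda>y. norm (s i y - f y))"
        using lim by auto
      have d': "integrable lborel (\<lambda>y. norm (s i (y + h n) - f (y + h n)))"
        using integrable_lborel_translate[OF d] .
      have d'': "integrable lborel (\<lambda>y. norm (s i (y + h n) - s i y))"
        using lim by (auto intro!: integrable_norm integrable_diff integrable_lborel_translate)
      have "(\<integral>y. norm (f (y + h n) - f y) \<partial>lborel)
        \<le> (\<integral>y. norm (s i (y + h n) - f (y + h n)) + norm (s i (y + h n) - s i y) + norm (s i y - f y) \<partial>lborel)"
      proof (rule integral_mono)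
        show "integrable lborel (\<lambda>y. norm (f (y + h n) - f y))"
          using lim by (auto intro!: integrable_norm integrable_diff integrable_lborel_translate)
        fix y
        have "f (y + h n) - f y = - (s i (y + h n) - f (y + h n)) + (s i (y + h n) - s i y) + (s i y - f y)"
          by simp
        then show "norm (f (y + h n) - f y) \<le> norm (s i (y + h n) - f (y + h n)) + norm (s i (y + h n) - s i y) + norm (s i y - f y)"
          by (metis (no_types, opaque_lifting) norm_minus_cancel norm_triangle_le add_right_mono norm_triangle_ineq)
      qed (use d d' d'' in auto)
      also have "\<dots> = (\<integral>y. norm (s i (y + h n) - f (y + h n)) \<partial>lborel) + (\<integral>y. norm (s i (y + h n) - s i y) \<partial>lborel)
          + (\<integral>y. norm (s i y - f y) \<partial>lborel)"
        using d d' d'' by simp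
      also have "(\<integral>y. norm (s i (y + h n) - f (y + h n)) \<partial>lborel) = (\<integral>y. norm (s i y - f y) \<partial>lborel)"
        using lim by (intro integral_lborel_translate[of "\<lambda>y. norm (s i y - f y)"]) auto
      finally show ?case using i elim by (simp add: integral_nonneg)
    qed
    then show "\<exists>no. \<forall>n\<ge>no. norm ((\<integral>y. norm (f (y + h n) - f y) \<partial>lborel) - 0) < e"
      by (simp add: eventually_sequentially)
  qed
qed

section \<open>Fourier transform and autocorrelation\<close>

text \<open>The phase has the sign of \<open>ext_op\<close> and there is no normalising factor; this
  is why \<open>plancherel\<close> carries a power of \<open>2 * pi\<close>.\<close>

definition fourier :: "('a::euclidean_space \<Rightarrow> complex) \<Rightarrow> 'a \<Rightarrow> complex" where
  "fourier f p = (\<integral>y. f y * cis (p \<bullet> y) \<partial>lborel)"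

text \<open>Its Fourier transform is \<open>|fourier f|^2\<close> and its value at \<open>0\<close>
  is the squared L2 norm, so Plancherel's identity is Fourier inversion of \<open>autocorr f\<close>
  at the origin.\<close>

definition autocorr :: "('a::euclidean_space \<Rightarrow> complex) \<Rightarrow> 'a \<Rightarrow> complex" where
  "autocorr f h = (\<integral>z. f (z + h) * cnj (f z) \<partial>lborel)"

text \<open>The free weight \<open>l\<close> is the point: a large \<open>l\<close> puts the cost on
  the factor \<open>a\<close>, which will be a small tail, and makes the other square cheap.\<close>

lemma mult_le_weighted_squares:
  fixes a b l :: real
  assumes "0 < l"
  shows "a * b \<le> l * a\<^sup>2 + b\<^sup>2 / l"
proof -
  have "0 \<le> (l * a - b)\<^sup>2 / l + l * a\<^sup>2 + b\<^sup>2 / l"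
    using assms by simp
  also have "\<dots> = 2 * (l * a\<^sup>2 + b\<^sup>2 / l - a * b)"
    using assms by (simp add: power2_eq_square field_simps)
  finally show ?thesis by simp
qed

lemma borel_measurable_cis[measurable (raw)]:
  "f \<in> borel_measurable M \<Longrightarrow> (\<lambda>x. cis (f x)) \<in> borel_measurable M"
  by (rule borel_measurable_continuous_on[of cis]) (auto intro!: continuous_intros)

lemma borel_measurable_cnj[measurable (raw)]:
  "f \<in> borel_measurable M \<Longrightarrow> (\<lambda>x. cnj (f x)) \<in> borel_measurable M"
  by (rule borel_measurable_continuous_on[of cnj]) (auto intro!: continuous_intros)

context
  fixes f :: "'a::euclidean_space \<Rightarrow> complex"
  assumes f1: "integrable lborel f" and f2: "integrable lborel (\<lambda>y. (norm (f y))\<^sup>2)"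
begin

lemma borel_measurable_of_integrable_lborel[measurable]: "f \<in> borel_measurable borel"
  using f1 by (auto dest: borel_measurable_integrable)

lemma integrable_autocorr_integrand: "integrable lborel (\<lambda>z. f (z + h) * cnj (f z))"
proof (rule Bochner_Integration.integrable_bound)
  show "integrable lborel (\<lambda>z. (norm (f (z + h)))\<^sup>2 + (norm (f z))\<^sup>2)"
    using integrable_lborel_translate[OF f2, of h] f2 by auto
  show "AE z in lborel. norm (f (z + h) * cnj (f z)) \<le> norm ((norm (f (z + h)))\<^sup>2 + (norm (f z))\<^sup>2)"
    using mult_le_weighted_squares[of 1] by (auto simp: norm_mult)
qed auto

lemma norm_autocorr_le: "norm (autocorr f h) \<le> 2 * (\<integral>y. (norm (f y))\<^sup>2 \<partial>lborel)"
proof -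
  have "norm (autocorr f h) \<le> (\<integral>z. (norm (f (z + h)))\<^sup>2 + (norm (f z))\<^sup>2 \<partial>lborel)"
    unfolding autocorr_def
  proof (rule Bochner_Integration.integral_norm_bound_integral[OF integrable_autocorr_integrand])
    show "integrable lborel (\<lambda>z. (norm (f (z + h)))\<^sup>2 + (norm (f z))\<^sup>2)"
      using integrable_lborel_translate[OF f2, of h] f2 by auto
    show "norm (f (z + h) * cnj (f z)) \<le> (norm (f (z + h)))\<^sup>2 + (norm (f z))\<^sup>2" for z
      using mult_le_weighted_squares[of 1] by (auto simp: norm_mult)
  qed
  also have "\<dots> = 2 * (\<integral>y. (norm (f y))\<^sup>2 \<partial>lborel)"
    using integrable_lborel_translate[OF f2, of h] f2
      integral_lborel_translate[of "\<lambda>z. (norm (f z))\<^sup>2" h] by simp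
  finally show ?thesis .
qed

lemma autocorr_0: "autocorr f 0 = (\<integral>y. (norm (f y))\<^sup>2 \<partial>lborel)"
  unfolding autocorr_def by (simp add: complex_norm_square[symmetric] flip: of_real_power integral_complex_of_real)

text \<open>An unbounded \<open>f\<close> is cut off at height \<open>M\<close>: on the bounded part continuity of
  translations in \<open>L\<^sup>1\<close> applies, and the tail is small in \<open>L\<^sup>2\<close>.\<close>

lemma autocorr_tendsto:
  assumes h: "h \<longlonglongrightarrow> 0"
  shows "(\<lambda>n. autocorr f (h n)) \<longlonglongrightarrow> autocorr f 0"
proof (rule LIMSEQ_I)
  fix e :: real assume e: "0 < e"
  define S where "S = (\<integral>y. (norm (f y))\<^sup>2 \<partial>lborel)"
  have S0: "0 \<le> S" unfolding S_def by (simp add: integral_nonneg)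
  \<comment> \<open>With this weight \<open>S / l \<le> e / 12\<close>; the summand 1 keeps
    \<open>l\<close> positive when \<open>S = 0\<close>.\<close>
  define l where "l = 12 * (S + 1) / e"
  have l: "0 < l" using e S0 by (simp add: l_def)
  \<comment> \<open>\<open>r M\<close> is \<open>norm f\<close> where it exceeds \<open>M\<close>;
    its L2 mass vanishes as \<open>M\<close> grows.\<close>
  define r where "r = (\<lambda>M y. if norm (f y) \<le> M then 0 else norm (f y) :: real)"
  have [measurable]: "r M \<in> borel_measurable borel" for M unfolding r_def by measurable
  have "(\<lambda>n. \<integral>y. (r (real n) y)\<^sup>2 \<partial>lborel) \<longlonglongrightarrow> integral\<^sup>L lborel (\<lambda>y::'a. 0::real)"
  proof (rule integral_dominated_convergence[where w="\<lambda>y. (norm (f y))\<^sup>2"])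
    show "AE y in lborel. (\<lambda>n. (r (real n) y)\<^sup>2) \<longlonglongrightarrow> 0"
    proof (rule AE_I2)
      fix y
      obtain N where "norm (f y) \<le> real N" using real_arch_simple by blast
      then have "\<forall>\<^sub>F n in sequentially. (r (real n) y)\<^sup>2 = 0"
        unfolding eventually_sequentially r_def by (intro exI[of _ N]) auto
      then show "(\<lambda>n. (r (real n) y)\<^sup>2) \<longlonglongrightarrow> 0" by (rule tendsto_eventually)
    qed
  qed (use f2 in \<open>auto simp: r_def\<close>)
  then have "\<forall>\<^sub>F n in sequentially. (\<integral>y. (r (real n) y)\<^sup>2 \<partial>lborel) < e / (8 * l)"
    using e l by (intro order_tendstoD(2)) auto
  then obtain N where N: "(\<integral>y. (r (real N) y)\<^sup>2 \<partial>lborel) < e / (8 * l)"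
    by (auto simp: eventually_sequentially)
  have r2: "integrable lborel (\<lambda>y. (r (real N) y)\<^sup>2)"
    by (rule Bochner_Integration.integrable_bound[OF f2]) (auto simp: r_def)
  have "\<forall>\<^sub>F n in sequentially. (\<integral>y. norm (f (y + h n) - f y) \<partial>lborel) < e / (4 * (real N + 1))"
    using e by (intro order_tendstoD(2)[OF L1_translation_tendsto[OF f1 h]]) auto
  then have "\<forall>\<^sub>F n in sequentially. norm (autocorr f (h n) - autocorr f 0) < e"
  proof eventually_elim
    case (elim n)
    have i1: "integrable lborel (\<lambda>y. norm (f (y + h n) - f y))"
      using f1 by (auto intro!: integrable_norm integrable_diff integrable_lborel_translate)
    have i2: "integrable lborel (\<lambda>y. (norm (f (y + h n)))\<^sup>2)"
      by (rule integrable_lborel_translate[OF f2])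
    have "autocorr f (h n) - autocorr f 0 = (\<integral>y. f (y + h n) * cnj (f y) - f (y + 0) * cnj (f y) \<partial>lborel)"
      unfolding autocorr_def using integrable_autocorr_integrand[of "h n"] integrable_autocorr_integrand[of 0] by simp
    \<comment> \<open>Below height \<open>N\<close> the difference is at most \<open>N\<close> times
      the translation error. Above it both products are split with weight \<open>l\<close>, which
      produces \<open>2 * l * (r N y)^2\<close> and the two squares over \<open>l\<close>. Adding
      both bounds avoids a case distinction under the integral.\<close>
    also have "norm \<dots> \<le> (\<integral>y. N * norm (f (y + h n) - f y) + 2 * l * (r N y)\<^sup>2
        + ((norm (f (y + h n)))\<^sup>2 / l + (norm (f y))\<^sup>2 / l) \<partial>lborel)"
    proof (rule Bochner_Integration.integral_norm_bound_integral)
      fix y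
      show "norm (f (y + h n) * cnj (f y) - f (y + 0) * cnj (f y)) \<le>
        N * norm (f (y + h n) - f y) + 2 * l * (r N y)\<^sup>2
        + ((norm (f (y + h n)))\<^sup>2 / l + (norm (f y))\<^sup>2 / l)"
      proof (cases "norm (f y) \<le> N")
        case True
        have "norm (f (y + h n) * cnj (f y) - f (y + 0) * cnj (f y)) = norm (f y) * norm (f (y + h n) - f y)"
          by (metis (no_types) add.right_neutral complex_mod_cnj left_diff_distrib mult.commute norm_mult)
        also have "\<dots> \<le> N * norm (f (y + h n) - f y)"
          using True by (intro mult_right_mono) auto
        finally show ?thesis
          using l by (simp add: add_increasing2)
      next
        case False
        then have r: "r N y = norm (f y)" by (simp add: r_def)
        have "norm (f (y + h n) * cnj (f y) - f (y + 0) * cnj (f y))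
            \<le> norm (f y) * norm (f (y + h n)) + norm (f y) * norm (f y)"
          using norm_triangle_ineq4[of "f (y + h n) * cnj (f y)" "f (y + 0) * cnj (f y)"]
          by (simp add: norm_mult mult.commute)
        also have "\<dots> \<le> (l * (norm (f y))\<^sup>2 + (norm (f (y + h n)))\<^sup>2 / l) + (l * (norm (f y))\<^sup>2 + (norm (f y))\<^sup>2 / l)"
          by (intro add_mono mult_le_weighted_squares l)
        finally show ?thesis
          unfolding r by (simp add: add_increasing add.assoc)
      qed
    qed (use i1 i2 r2 f2 integrable_autocorr_integrand[of "h n"] integrable_autocorr_integrand[of 0] in auto)
    also have "\<dots> = N * (\<integral>y. norm (f (y + h n) - f y) \<partial>lborel) + 2 * l * (\<integral>y. (r N y)\<^sup>2 \<partial>lborel)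
        + ((\<integral>y. (norm (f (y + h n)))\<^sup>2 \<partial>lborel) / l + S / l)"
      using i1 i2 r2 f2 by (simp add: S_def)
    also have "(\<integral>y. (norm (f (y + h n)))\<^sup>2 \<partial>lborel) = S"
      unfolding S_def by (rule integral_lborel_translate[of "\<lambda>y. (norm (f y))\<^sup>2"]) simp
    also have "N * (\<integral>y. norm (f (y + h n) - f y) \<partial>lborel) + 2 * l * (\<integral>y. (r N y)\<^sup>2 \<partial>lborel) + (S / l + S / l)
       < e / 4 + e / 4 + (e / 12 + e / 12)"
    proof -
      have "real N * (\<integral>y. norm (f (y + h n) - f y) \<partial>lborel) \<le> (real N + 1) * (\<integral>y. norm (f (y + h n) - f y) \<partial>lborel)"
        by (intro mult_right_mono) (auto simp: integral_nonneg)
      also have "\<dots> < e / 4"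
        using elim by (simp add: field_simps)
      finally have "real N * (\<integral>y. norm (f (y + h n) - f y) \<partial>lborel) < e / 4" .
      moreover have "2 * l * (\<integral>y. (r N y)\<^sup>2 \<partial>lborel) \<le> e / 4"
        using N l by (simp add: field_simps)
      moreover have "S / l \<le> e / 12"
        using S0 e by (simp add: l_def field_simps)
      ultimately show ?thesis by linarith
    qed
    also have "\<dots> < e" using e by simp
    finally show ?case .
  qed
  then show "\<exists>no. \<forall>n\<ge>no. norm (autocorr f (h n) - autocorr f 0) < e"
    by (simp add: eventually_sequentially)
qed

text \<open>By translation invariance the inner integral of the norm over \<open>h\<close> is
  \<open>norm (f z)\<close> times the L1 norm of \<open>f\<close>.\<close>

lemma integrable_autocorr_pair:
  "integrable (lborel \<Otimes>\<^sub>M lborel) (\<lambda>(z, h). f (z + h) * cnj (f z))"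
proof (rule lborel_pair.Fubini_integrable)
  have "(\<integral>h. norm (f (z + h) * cnj (f z)) \<partial>lborel) = (\<integral>y. norm (f y) \<partial>lborel) * norm (f z)" for z
    using integral_lborel_translate[of "\<lambda>y. norm (f y)" z] by (simp add: norm_mult add.commute)
  then show "integrable lborel (\<lambda>z. \<integral>h. norm (case (z, h) of (z, h) \<Rightarrow> f (z + h) * cnj (f z)) \<partial>lborel)"
    using f1 by auto
  show "AE z in lborel. integrable lborel (\<lambda>h. case (z, h) of (z, h) \<Rightarrow> f (z + h) * cnj (f z))"
    using integrable_lborel_translate[OF f1] by (auto simp: add.commute)
qed measurable

lemma integrable_autocorr: "integrable lborel (autocorr f)"
  using lborel_pair.integrable_snd[OF integrable_autocorr_pair] by (simp add: autocorr_def[abs_def])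

text \<open>Since \<open>cis (p \<bullet> h) = cnj (cis (p \<bullet> z)) * cis (p \<bullet> (h +
  z))\<close>, Fubini and a translation split the double integral into
  \<open>cnj (fourier f p) * fourier f p\<close>.\<close>

lemma norm_fourier_square: "complex_of_real ((norm (fourier f p))\<^sup>2) = fourier (autocorr f) p"
proof -
  have i: "integrable (lborel \<Otimes>\<^sub>M lborel) (\<lambda>(z, h). f (z + h) * cnj (f z) * cis (p \<bullet> h))"
    by (rule Bochner_Integration.integrable_bound[OF integrable_autocorr_pair]) (auto simp: norm_mult)
  have "fourier (autocorr f) p = (\<integral>h. (\<integral>z. f (z + h) * cnj (f z) * cis (p \<bullet> h) \<partial>lborel) \<partial>lborel)"
    by (simp add: fourier_def autocorr_def)
  also have "\<dots> = (\<integral>z. (\<integral>h. f (z + h) * cnj (f z) * cis (p \<bullet> h) \<partial>lborel) \<partial>lborel)"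
    by (rule lborel_pair.Fubini_integral[OF i])
  also have "\<dots> = (\<integral>z. cnj (f z * cis (p \<bullet> z)) * fourier f p \<partial>lborel)"
  proof (rule Bochner_Integration.integral_cong[OF refl])
    fix z
    have "f (z + h) * cnj (f z) * cis (p \<bullet> h) = cnj (f z * cis (p \<bullet> z)) * (f (h + z) * cis (p \<bullet> (h + z)))" for h
    proof -
      have "cis (p \<bullet> h) = cnj (cis (p \<bullet> z)) * cis (p \<bullet> (h + z))"
        by (simp add: cis_cnj cis_mult inner_add_right)
      then show ?thesis
        by (simp only: complex_cnj_mult mult_ac add.commute[of z h])
    qed
    then have "(\<integral>h. f (z + h) * cnj (f z) * cis (p \<bullet> h) \<partial>lborel) 
        = (\<integral>h. cnj (f z * cis (p \<bullet> z)) * (f (h + z) * cis (p \<bullet> (h + z))) \<partial>lborel)"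
      by (simp only:)
    also have "\<dots> = cnj (f z * cis (p \<bullet> z)) * (\<integral>h. f (h + z) * cis (p \<bullet> (h + z)) \<partial>lborel)"
      by simp
    also have "(\<integral>h. f (h + z) * cis (p \<bullet> (h + z)) \<partial>lborel) = fourier f p"
      unfolding fourier_def by (rule integral_lborel_translate[of "\<lambda>y. f y * cis (p \<bullet> y)"]) simp
    finally show "(\<integral>h. f (z + h) * cnj (f z) * cis (p \<bullet> h) \<partial>lborel) = cnj (f z * cis (p \<bullet> z)) * fourier f p" .
  qed
  also have "\<dots> = (\<integral>z. cnj (f z * cis (p \<bullet> z)) \<partial>lborel) * fourier f p"
    by simp
  also have "(\<integral>z. cnj (f z * cis (p \<bullet> z)) \<partial>lborel) = cnj (fourier f p)"
    unfolding fourier_def by (rule Bochner_Integration.integral_cnj)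
  finally show ?thesis
    by (metis complex_norm_square mult.commute)
qed

end

section \<open>Fourier transforms of Gaussians and Plancherel's identity\<close>

text \<open>Lebesgue measure is the image of a product of one-dimensional measures over
  \<open>Basis\<close> under coordinate expansion, so both claims are Fubini for finite products.
  They reduce Gaussians to dimension one.\<close>

lemma
  fixes g :: "'a::euclidean_space \<Rightarrow> real \<Rightarrow> complex"
  assumes g: "\<And>b. b \<in> Basis \<Longrightarrow> integrable lborel (g b)"
  shows integrable_lborel_prod: "integrable lborel (\<lambda>x::'a. \<Prod>b\<in>Basis. g b (x \<bullet> b))"
    and integral_lborel_prod: "(\<integral>x. (\<Prod>b\<in>Basis. g b (x \<bullet> b)) \<partial>lborel) = (\<Prod>b\<in>Basis. \<integral>x. g b x \<partial>lborel)"
proof -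
  interpret product_sigma_finite "\<lambda>_::'a. lborel :: real measure" ..
  have [measurable]: "g b \<in> borel_measurable borel" if "b \<in> Basis" for b
    using g[OF that] by (auto dest: borel_measurable_integrable)
  have m: "(\<lambda>x::'a. \<Prod>b\<in>Basis. g b (x \<bullet> b)) \<in> borel_measurable borel"
    by measurable
  have eq: "(\<Prod>b\<in>Basis. g b ((\<Sum>b\<in>Basis. f b *\<^sub>R b) \<bullet> b)) = (\<Prod>b\<in>Basis. g b (f b))" for f :: "'a \<Rightarrow> real"
    by (intro prod.cong) auto
  show "integrable lborel (\<lambda>x::'a. \<Prod>b\<in>Basis. g b (x \<bullet> b))"
    by (subst lborel_eq, subst integrable_distr_eq) (use m g in \<open>auto simp: eq intro!: product_integrable_prod\<close>)
  have "(\<integral>x. (\<Prod>b\<in>Basis. g b (x \<bullet> b)) \<partial>lborel) = (\<integral>f. (\<Prod>b\<in>Basis. g b (f b)) \<partial>(\<Pi>\<^sub>M b\<in>Basis. lborel))"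
    by (subst lborel_eq, subst integral_distr) (use m in \<open>auto simp: eq\<close>)
  also have "\<dots> = (\<Prod>b\<in>Basis. \<integral>x. g b x \<partial>lborel)"
    by (rule product_integral_prod) (use g in auto)
  finally show "(\<integral>x. (\<Prod>b\<in>Basis. g b (x \<bullet> b)) \<partial>lborel) = (\<Prod>b\<in>Basis. \<integral>x. g b x \<partial>lborel)" .
qed

text \<open>Up to the factor \<open>sqrt (2 * pi)\<close> this is the characteristic function of the
  standard normal distribution.\<close>

lemma gaussian_fourier_real:
  fixes t :: real
  shows "integrable lborel (\<lambda>x. complex_of_real (exp (- x\<^sup>2 / 2)) * cis (x * t))"
    and "(\<integral>x. complex_of_real (exp (- x\<^sup>2 / 2)) * cis (x * t) \<partial>lborel) = complex_of_real (sqrt (2 * pi) * exp (- t\<^sup>2 / 2))"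
proof -
  have d: "complex_of_real (exp (- x\<^sup>2 / 2)) = complex_of_real (sqrt (2 * pi)) * std_normal_density x" for x
    by (simp add: std_normal_density_def)
  have i: "integrable lborel std_normal_density"
    by simp
  have "integrable lborel (\<lambda>x. complex_of_real (std_normal_density x) * cis (x * t))"
    by (rule Bochner_Integration.integrable_bound[OF i]) (auto simp: norm_mult)
  then have "integrable lborel (\<lambda>x. complex_of_real (sqrt (2 * pi)) * (complex_of_real (std_normal_density x) * cis (x * t)))"
    by (rule integrable_mult_right)
  then show "integrable lborel (\<lambda>x. complex_of_real (exp (- x\<^sup>2 / 2)) * cis (x * t))"
    unfolding d by (simp only: mult.assoc)
  have "(\<integral>x. complex_of_real (std_normal_density x) * cis (x * t) \<partial>lborel) = char std_normal_distribution t"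
    unfolding char_def
    by (subst integral_density) (auto simp: scaleR_conv_of_real cis_conv_exp mult_ac)
  then have "(\<integral>x. complex_of_real (sqrt (2 * pi)) * (complex_of_real (std_normal_density x) * cis (x * t)) \<partial>lborel)
     = complex_of_real (sqrt (2 * pi) * exp (- t\<^sup>2 / 2))"
    by (simp add: char_std_normal_distribution)
  then show "(\<integral>x. complex_of_real (exp (- x\<^sup>2 / 2)) * cis (x * t) \<partial>lborel) = complex_of_real (sqrt (2 * pi) * exp (- t\<^sup>2 / 2))"
    unfolding d by (simp only: mult.assoc)
qed

text \<open>Left unnormalised so that its value at \<open>0\<close> is 1: its dilates then increase
  to the constant 1 and serve as cutoffs, while its transform is a multiple of itself.\<close>

definition gauss :: "'a::euclidean_space \<Rightarrow> real" where
  "gauss x = exp (- (norm x)\<^sup>2 / 2)"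

lemma gauss_measurable[measurable]: "gauss \<in> borel_measurable borel"
  unfolding gauss_def[abs_def] by measurable

lemma gauss_eq_prod: "gauss x = (\<Prod>b\<in>Basis. exp (- (x \<bullet> b)\<^sup>2 / 2))"
proof -
  have "(norm x)\<^sup>2 = (\<Sum>b\<in>Basis. (x \<bullet> b)\<^sup>2)"
    unfolding power2_norm_eq_inner euclidean_inner[of x x] by (simp only: power2_eq_square)
  then show ?thesis
    by (simp add: gauss_def exp_sum[symmetric] sum_negf sum_divide_distrib)
qed

lemma cis_sum: "finite A \<Longrightarrow> cis (\<Sum>a\<in>A. f a) = (\<Prod>a\<in>A. cis (f a))"
  by (induction A rule: finite_induct) (auto simp: cis_mult[symmetric])

lemma gaussian_fourier:
  fixes y :: "'a::euclidean_space"
  shows "integrable lborel (\<lambda>p::'a. complex_of_real (gauss p) * cis (p \<bullet> y))"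
    and "(\<integral>p. complex_of_real (gauss p) * cis (p \<bullet> y) \<partial>lborel) = complex_of_real (sqrt (2 * pi) ^ DIM('a) * gauss y)"
proof -
  have eq: "(\<Prod>b\<in>Basis. complex_of_real (exp (- (p \<bullet> b)\<^sup>2 / 2)) * cis ((p \<bullet> b) * (y \<bullet> b)))
      = complex_of_real (gauss p) * cis (p \<bullet> y)" for p
    by (simp only: prod.distrib gauss_eq_prod of_real_prod cis_sum[OF finite_Basis, symmetric]
         euclidean_inner[of p y, symmetric])
  have eq2: "(\<Prod>b\<in>Basis. complex_of_real (sqrt (2 * pi) * exp (- (y \<bullet> b)\<^sup>2 / 2)))
      = complex_of_real (sqrt (2 * pi) ^ DIM('a) * gauss y)"
    by (simp add: gauss_eq_prod prod.distrib)
  note g = gaussian_fourier_real(1)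
  show "integrable lborel (\<lambda>p::'a. complex_of_real (gauss p) * cis (p \<bullet> y))"
    using integrable_lborel_prod[where g="\<lambda>b x. complex_of_real (exp (- x\<^sup>2 / 2)) * cis (x * (y \<bullet> b))", OF g]
    by (simp only: eq)
  show "(\<integral>p. complex_of_real (gauss p) * cis (p \<bullet> y) \<partial>lborel) = complex_of_real (sqrt (2 * pi) ^ DIM('a) * gauss y)"
    using integral_lborel_prod[where g="\<lambda>b x. complex_of_real (exp (- x\<^sup>2 / 2)) * cis (x * (y \<bullet> b))", OF g]
    unfolding eq gaussian_fourier_real(2) by (rule trans[OF _ eq2])
qed

lemma integrable_gauss: "integrable lborel (gauss :: 'a::euclidean_space \<Rightarrow> real)"
proof -
  have "integrable lborel (\<lambda>p::'a. complex_of_real (gauss p))"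
    using gaussian_fourier(1)[of "0::'a"] by simp
  from integrable_Re[OF this] show ?thesis by simp
qed

lemma integral_gauss: "integral\<^sup>L lborel (gauss :: 'a::euclidean_space \<Rightarrow> real) = sqrt (2 * pi) ^ DIM('a)"
proof -
  have "complex_of_real (integral\<^sup>L lborel (gauss :: 'a \<Rightarrow> real)) = complex_of_real (sqrt (2 * pi) ^ DIM('a) * gauss (0::'a))"
    using gaussian_fourier(2)[of "0::'a"]
    by (simp only: inner_zero_right cis_zero mult_1_right integral_complex_of_real)
  then have "integral\<^sup>L lborel (gauss :: 'a \<Rightarrow> real) = sqrt (2 * pi) ^ DIM('a) * gauss (0::'a)"
    by (simp only: of_real_eq_iff)
  then show ?thesis by (simp add: gauss_def)
qed

lemma integrable_lborel_scaleR:
  fixes f :: "'a::euclidean_space \<Rightarrow> 'b::{banach,second_countable_topology}"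
  assumes f: "integrable lborel f" and c: "c \<noteq> 0"
  shows "integrable lborel (\<lambda>x. f (c *\<^sub>R x))"
proof -
  have [measurable]: "f \<in> borel_measurable borel"
    using f by (auto dest: borel_measurable_integrable)
  have "integrable (density (distr lborel borel (\<lambda>x. 0 + c *\<^sub>R x)) (\<lambda>_. ennreal (\<bar>c\<bar> ^ DIM('a)))) f"
    by (rule back_subst[where P="\<lambda>M. integrable M f", OF f lborel_affine[OF c]])
  then have "integrable lborel (\<lambda>x. \<bar>c\<bar> ^ DIM('a) *\<^sub>R f (c *\<^sub>R x))"
    by (subst (asm) integrable_density) (auto simp: integrable_distr_eq)
  from integrable_scaleR_right[OF this, of "inverse (\<bar>c\<bar> ^ DIM('a))"] show ?thesis
    using c by simp
qed

text \<open>Integrability of \<open>fourier (autocorr f)\<close> is not known in advance, so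
  inversion at \<open>0\<close> is done with Gaussian cutoffs \<open>w i\<close> increasing to 1.
  Fubini moves the transform onto \<open>w i\<close>, which becomes an approximate identity;
  boundedness of the autocorrelation and its continuity at \<open>0\<close> give the limit, and
  monotone convergence returns both integrability and value.\<close>

theorem plancherel:
  fixes f :: "'a::euclidean_space \<Rightarrow> complex"
  assumes f1: "integrable lborel f" and f2: "integrable lborel (\<lambda>y. (norm (f y))\<^sup>2)"
  shows "integrable lborel (\<lambda>p. (norm (fourier f p))\<^sup>2)"
    and "(\<integral>p. (norm (fourier f p))\<^sup>2 \<partial>lborel) = (2 * pi) ^ DIM('a) * (\<integral>y. (norm (f y))\<^sup>2 \<partial>lborel)"
proof -
  note [measurable] = borel_measurable_integrable[OF f1, simplified] borel_measurable_integrable[OF f2, simplified]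
    borel_measurable_integrable[OF integrable_autocorr[OF f1 f2], simplified]
  have meas[measurable]: "fourier f \<in> borel_measurable borel"
  proof -
    have "(\<lambda>p. \<integral>y. (case (p, y) of (p, y) \<Rightarrow> f y * cis (p \<bullet> y)) \<partial>lborel) \<in> borel_measurable borel"
      by (rule lborel.borel_measurable_lebesgue_integral) measurable
    then show ?thesis by (simp add: fourier_def[abs_def])
  qed
  let ?A = "autocorr f"
  let ?n = "DIM('a)"
  define S where "S = sqrt (2 * pi) ^ ?n"
  define k where "k i = real (Suc i)" for i
  have k: "0 < k i" for i by (simp add: k_def)
  define w where "w i p = gauss (p /\<^sub>R k i)" for i and p :: 'a
  have [measurable]: "w i \<in> borel_measurable borel" for i
    unfolding w_def by measurable
  have w1: "0 \<le> w i p" "w i p \<le> 1" for i p by (simp_all add: w_def gauss_def)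
  have wscale: "w i (k i *\<^sub>R q) = gauss q" for i q
    using k[of i] by (simp add: w_def)
  have iw: "integrable lborel (w i)" for i
    unfolding w_def using integrable_lborel_scaleR[OF integrable_gauss, of "inverse (k i)"] k[of i] by simp
  have wF: "(\<integral>p. complex_of_real (w i p) * cis (p \<bullet> h) \<partial>lborel) = of_real (k i ^ ?n * (S * gauss (k i *\<^sub>R h)))" for i h
  proof -
    have "(\<integral>p. complex_of_real (w i p) * cis (p \<bullet> h) \<partial>lborel)
       = (k i ^ ?n) *\<^sub>R (\<integral>q. complex_of_real (gauss q) * cis (q \<bullet> (k i *\<^sub>R h)) \<partial>lborel)"
      by (subst integral_lborel_scaleR[OF _ k[of i]]) (simp_all add: wscale)
    also have "\<dots> = (k i ^ ?n) *\<^sub>R complex_of_real (S * gauss (k i *\<^sub>R h))"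
      by (simp only: gaussian_fourier(2) S_def)
    finally show ?thesis by (simp add: scaleR_conv_of_real)
  qed
  have ip: "integrable (lborel \<Otimes>\<^sub>M lborel) (\<lambda>(p, h). complex_of_real (w i p) * (?A h * cis (p \<bullet> h)))" for i
  proof (rule lborel_pair.Fubini_integrable)
    show "integrable lborel (\<lambda>p. \<integral>h. norm (case (p, h) of (p, h) \<Rightarrow> complex_of_real (w i p) * (?A h * cis (p \<bullet> h))) \<partial>lborel)"
      using iw w1 by (simp add: norm_mult)
    show "AE p in lborel. integrable lborel (\<lambda>h. case (p, h) of (p, h) \<Rightarrow> complex_of_real (w i p) * (?A h * cis (p \<bullet> h)))"
      by (auto intro!: AE_I2 integrable_mult_right Bochner_Integration.integrable_bound[OF integrable_autocorr[OF f1 f2]] simp: norm_mult)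
  qed measurable
  have ift: "integrable lborel (\<lambda>p. w i p * (norm (fourier f p))\<^sup>2)" for i
  proof -
    have "integrable lborel (\<lambda>p. \<integral>h. complex_of_real (w i p) * (?A h * cis (p \<bullet> h)) \<partial>lborel)"
      using lborel_pair.integrable_fst[OF ip] by simp
    then have "integrable lborel (\<lambda>p. complex_of_real (w i p * (norm (fourier f p))\<^sup>2))"
      by (simp add: fourier_def[of ?A, symmetric] norm_fourier_square[OF f1 f2, symmetric])
    from integrable_Re[OF this] show ?thesis by simp
  qed
  have val: "complex_of_real (\<integral>p. w i p * (norm (fourier f p))\<^sup>2 \<partial>lborel)
      = S * (\<integral>u. ?A (u /\<^sub>R k i) * gauss u \<partial>lborel)" for i
  proof -
    have "complex_of_real (\<integral>p. w i p * (norm (fourier f p))\<^sup>2 \<partial>lborel)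
      = (\<integral>p. complex_of_real (w i p) * fourier ?A p \<partial>lborel)"
      by (simp add: norm_fourier_square[OF f1 f2, symmetric] flip: integral_complex_of_real)
    also have "\<dots> = (\<integral>p. (\<integral>h. complex_of_real (w i p) * (?A h * cis (p \<bullet> h)) \<partial>lborel) \<partial>lborel)"
      by (simp add: fourier_def)
    also have "\<dots> = (\<integral>h. (\<integral>p. complex_of_real (w i p) * (?A h * cis (p \<bullet> h)) \<partial>lborel) \<partial>lborel)"
      by (rule lborel_pair.Fubini_integral[symmetric, OF ip])
    also have "\<dots> = (\<integral>h. ?A h * (\<integral>p. complex_of_real (w i p) * cis (p \<bullet> h) \<partial>lborel) \<partial>lborel)"
      by (simp add: mult.left_commute)
    also have "\<dots> = (\<integral>h. ?A h * of_real (k i ^ ?n * (S * gauss (k i *\<^sub>R h))) \<partial>lborel)"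
      by (simp only: wF)
    also have "\<dots> = S * (k i ^ ?n) * (\<integral>h. ?A h * gauss (k i *\<^sub>R h) \<partial>lborel)"
      by (subst integral_mult_right_zero[symmetric]) (simp add: mult_ac)
    \<comment> \<open>Substituting \<open>h = u / k i\<close> cancels the factor
      \<open>k i ^ ?n\<close> and leaves the autocorrelation evaluated ever closer to
      \<open>0\<close>.\<close>
    also have "(\<integral>h. ?A h * gauss (k i *\<^sub>R h) \<partial>lborel) 
        = (1 / k i) ^ ?n *\<^sub>R (\<integral>u. ?A (u /\<^sub>R k i) * gauss u \<partial>lborel)"
      using k[of i] by (subst integral_lborel_scaleR[of _ "1 / k i"]) (simp_all add: inverse_eq_divide)
    finally show ?thesis
      using k[of i] by (simp add: scaleR_conv_of_real power_divide)
  qed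
  have lim: "(\<lambda>i. \<integral>u. ?A (u /\<^sub>R k i) * gauss u \<partial>lborel) \<longlonglongrightarrow> integral\<^sup>L lborel (\<lambda>u::'a. ?A 0 * complex_of_real (gauss u))"
  proof (rule integral_dominated_convergence[where w="\<lambda>u::'a. 2 * (\<integral>y. (norm (f y))\<^sup>2 \<partial>lborel) * gauss u"])
    show "AE u in lborel. (\<lambda>i. ?A (u /\<^sub>R k i) * gauss u) \<longlonglongrightarrow> ?A 0 * complex_of_real (gauss u)"
    proof (rule AE_I2)
      fix u :: 'a
      have "(\<lambda>i. inverse (k i)) \<longlonglongrightarrow> 0"
        unfolding k_def by (rule LIMSEQ_inverse_real_of_nat)
      then have "(\<lambda>i. u /\<^sub>R k i) \<longlonglongrightarrow> 0 *\<^sub>R u" by (intro tendsto_scaleR tendsto_const)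
      then show "(\<lambda>i. ?A (u /\<^sub>R k i) * gauss u) \<longlonglongrightarrow> ?A 0 * complex_of_real (gauss u)"
        by (intro tendsto_mult tendsto_const autocorr_tendsto[OF f1 f2]) simp
    qed
    show "AE u in lborel. norm (?A (u /\<^sub>R k i) * gauss u) \<le> 2 * (\<integral>y. (norm (f y))\<^sup>2 \<partial>lborel) * gauss u" for i
      using norm_autocorr_le[OF f1 f2] by (auto simp: norm_mult gauss_def)
  qed (use integrable_gauss in auto)
  have "(\<lambda>i. complex_of_real (\<integral>p. w i p * (norm (fourier f p))\<^sup>2 \<partial>lborel)) \<longlonglongrightarrow>
      complex_of_real (S * ((\<integral>y. (norm (f y))\<^sup>2 \<partial>lborel) * S))"
    unfolding val using tendsto_mult[OF tendsto_const lim, of "complex_of_real S"] 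
    by (simp add: autocorr_0[OF f1 f2] integral_gauss S_def)
  then have lim': "(\<lambda>i. \<integral>p. w i p * (norm (fourier f p))\<^sup>2 \<partial>lborel) \<longlonglongrightarrow>
      S * ((\<integral>y. (norm (f y))\<^sup>2 \<partial>lborel) * S)"
    by (rule tendsto_of_real_iff[THEN iffD1])
  have wmono: "w i p \<le> w j p" if "i \<le> j" for i j p
    using that k[of i] unfolding w_def gauss_def
    by (auto intro!: power_mono mult_right_mono simp: k_def inverse_le_iff_le)
  have wlim: "(\<lambda>i. w i p) \<longlonglongrightarrow> 1" for p
  proof -
    have "(\<lambda>i. inverse (k i)) \<longlonglongrightarrow> 0"
      unfolding k_def by (rule LIMSEQ_inverse_real_of_nat)
    then have "(\<lambda>i. exp (- (norm (p /\<^sub>R k i))\<^sup>2 / 2)) \<longlonglongrightarrow> exp (- (norm (0 *\<^sub>R p))\<^sup>2 / 2)"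
      by (intro tendsto_intros) auto
    then show ?thesis by (simp add: w_def gauss_def)
  qed
  note mc = integral_monotone_convergence_nonneg[where u="\<lambda>p. (norm (fourier f p))\<^sup>2", OF ift _ _ _ lim']
  \<comment> \<open>One factor \<open>S\<close> stems from the transform of the Gaussian, the other
    from its integral.\<close>
  have SS: "S * S = (2 * pi) ^ ?n"
    unfolding S_def power_mult_distrib[symmetric] by simp
  have a: "AE p in lborel. mono (\<lambda>i. w i p * (norm (fourier f p))\<^sup>2)"
    by (auto intro!: AE_I2 monoI mult_right_mono wmono)
  have b: "AE p in lborel. 0 \<le> w i p * (norm (fourier f p))\<^sup>2" for i
    using w1 by auto
  have c: "AE p in lborel. (\<lambda>i. w i p * (norm (fourier f p))\<^sup>2) \<longlonglongrightarrow> (norm (fourier f p))\<^sup>2"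
    using tendsto_mult[OF wlim tendsto_const] by (auto intro!: AE_I2)
  show "integrable lborel (\<lambda>p. (norm (fourier f p))\<^sup>2)"
    by (rule mc(1)[OF a b c]) simp
  have "(\<integral>p. (norm (fourier f p))\<^sup>2 \<partial>lborel) = S * ((\<integral>y. (norm (f y))\<^sup>2 \<partial>lborel) * S)"
    by (rule mc(2)[OF a b c]) simp
  also have "\<dots> = (S * S) * (\<integral>y. (norm (f y))\<^sup>2 \<partial>lborel)"
    by (simp only: mult_ac)
  finally show "(\<integral>p. (norm (fourier f p))\<^sup>2 \<partial>lborel) = (2 * pi) ^ ?n * (\<integral>y. (norm (f y))\<^sup>2 \<partial>lborel)"
    unfolding SS .
qed

section \<open>Level sets of strongly convex functions\<close>

text \<open>The derivative is linear, hence determined by its values on \<open>Basis\<close>, and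
  these are by definition the partials one order higher. Openness of \<open>V\<close> turns
  differentiability within \<open>V\<close> into differentiability at \<open>x\<close>.\<close>

lemma smooth_on_iter_pderiv_has_derivative:
  assumes "open V" "smooth_on V \<phi>" "set vs \<subseteq> Basis" "x \<in> V"
  shows "(iter_pderiv \<phi> vs has_derivative (\<lambda>v. \<Sum>i\<in>Basis. (v \<bullet> i) * iter_pderiv \<phi> (i # vs) x)) (at x)"
proof -
  have "iter_pderiv \<phi> vs differentiable (at x)"
    using assms unfolding smooth_on_def by (metis at_within_open differentiable_on_def)
  then have d: "(iter_pderiv \<phi> vs has_derivative frechet_derivative (iter_pderiv \<phi> vs) (at x)) (at x)"
    by (simp add: frechet_derivative_works)
  then have l: "linear (frechet_derivative (iter_pderiv \<phi> vs) (at x))"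
    by (rule has_derivative_linear)
  have "frechet_derivative (iter_pderiv \<phi> vs) (at x) v = (\<Sum>i\<in>Basis. (v \<bullet> i) * iter_pderiv \<phi> (i # vs) x)" for v
    by (subst euclidean_representation[of v, symmetric], subst linear_sum[OF l]) (simp add: linear_cmul[OF l])
  then have "frechet_derivative (iter_pderiv \<phi> vs) (at x) = (\<lambda>v. \<Sum>i\<in>Basis. (v \<bullet> i) * iter_pderiv \<phi> (i # vs) x)"
    by (rule ext)
  with d show ?thesis by (simp only:)
qed

lemma smooth_on_continuous_on_iter_pderiv:
  assumes "smooth_on V \<phi>" "set vs \<subseteq> Basis"
  shows "continuous_on V (iter_pderiv \<phi> vs)"
  using assms unfolding smooth_on_def by (auto intro: differentiable_imp_continuous_on)

text \<open>Along a segment in direction \<open>v\<close> the second derivative is the Hessian form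
  at \<open>v\<close> minus \<open>m\<close> times the squared norm of \<open>v\<close>, which is
  nonnegative by assumption; convexity on every segment is convexity.\<close>

lemma convex_on_of_hessian_ge:
  fixes \<phi> :: "'a::euclidean_space \<Rightarrow> real"
  assumes V: "open V" "smooth_on V \<phi>" and K: "convex K" "K \<subseteq> V"
    and m: "\<And>x v. x \<in> K \<Longrightarrow> m * (norm v)\<^sup>2 \<le> (\<Sum>i\<in>Basis. \<Sum>j\<in>Basis. (v \<bullet> i) * (v \<bullet> j) * hessian \<phi> x i j)"
  shows "convex_on K (\<lambda>x. \<phi> x - m / 2 * (norm x)\<^sup>2)"
proof (rule convex_onI[OF _ K(1)])
  fix t :: real and x y assume t: "0 < t" "t < 1" and xy: "x \<in> K" "y \<in> K"
  define v where "v = y - x"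
  define p where "p s = x + s *\<^sub>R v" for s
  have p_in: "p s \<in> K" if "s \<in> {0..1}" for s
  proof -
    have "p s = (1 - s) *\<^sub>R x + s *\<^sub>R y"
      by (simp add: p_def v_def algebra_simps)
    then show ?thesis
      using convexD_alt[OF K(1) xy, of s] that by simp
  qed
  have dp: "(p has_derivative (\<lambda>s. s *\<^sub>R v)) (at s)" for s
    unfolding p_def[abs_def] by (auto intro!: derivative_eq_intros)
  define f where "f s = \<phi> (p s) - m / 2 * (p s \<bullet> p s)" for s
  define f' where "f' s = (\<Sum>i\<in>Basis. (v \<bullet> i) * iter_pderiv \<phi> [i] (p s)) - m * (p s \<bullet> v)" for s
  define f'' where "f'' s = (\<Sum>i\<in>Basis. \<Sum>j\<in>Basis. (v \<bullet> i) * (v \<bullet> j) * hessian \<phi> (p s) i j) - m * (v \<bullet> v)" for s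
  have "convex_on {0..1} f"
  proof (rule f''_ge0_imp_convex)
    fix s :: real assume s: "s \<in> {0..1}"
    have ps: "p s \<in> V" using p_in[OF s] K by auto
    have "((\<lambda>s. \<phi> (p s)) has_derivative (\<lambda>h. \<Sum>i\<in>Basis. (h *\<^sub>R v \<bullet> i) * iter_pderiv \<phi> [i] (p s))) (at s)"
      using has_derivative_compose[OF dp smooth_on_iter_pderiv_has_derivative[OF V _ ps, of "[]"]]
      by (simp add: iter_pderiv.simps(1) del: iter_pderiv.simps(2))
    then have "((\<lambda>s. \<phi> (p s)) has_real_derivative (\<Sum>i\<in>Basis. (v \<bullet> i) * iter_pderiv \<phi> [i] (p s))) (at s)"
      unfolding has_field_derivative_def
      by (rule has_derivative_eq_rhs) (simp add: fun_eq_iff sum_distrib_left mult_ac del: iter_pderiv.simps)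
    moreover have "((\<lambda>s. p s \<bullet> p s) has_real_derivative 2 * (p s \<bullet> v)) (at s)"
      unfolding has_field_derivative_def
      by (rule has_derivative_eq_rhs[OF has_derivative_inner[OF dp dp]]) (auto simp: inner_commute)
    ultimately show "(f has_real_derivative f' s) (at s)"
      unfolding f_def[abs_def] f'_def by (auto intro!: derivative_eq_intros)
    have "((\<lambda>s. iter_pderiv \<phi> [j] (p s)) has_real_derivative (\<Sum>i\<in>Basis. (v \<bullet> i) * hessian \<phi> (p s) i j)) (at s)"
      if "j \<in> Basis" for j
    proof -
      have "((\<lambda>s. iter_pderiv \<phi> [j] (p s)) has_derivative (\<lambda>h. \<Sum>i\<in>Basis. (h *\<^sub>R v \<bullet> i) * iter_pderiv \<phi> [i, j] (p s))) (at s)"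
        using has_derivative_compose[OF dp smooth_on_iter_pderiv_has_derivative[OF V _ ps, of "[j]"]] that
        by (simp del: iter_pderiv.simps)
      then show ?thesis
        unfolding has_field_derivative_def hessian_def
        by (rule has_derivative_eq_rhs) (simp add: fun_eq_iff sum_distrib_left mult_ac del: iter_pderiv.simps)
    qed
    then have "((\<lambda>s. \<Sum>j\<in>Basis. (v \<bullet> j) * iter_pderiv \<phi> [j] (p s)) has_real_derivative
        (\<Sum>j\<in>Basis. (v \<bullet> j) * (\<Sum>i\<in>Basis. (v \<bullet> i) * hessian \<phi> (p s) i j))) (at s)"
      by (intro DERIV_sum DERIV_cmult) auto
    also have "(\<Sum>j\<in>Basis. (v \<bullet> j) * (\<Sum>i\<in>Basis. (v \<bullet> i) * hessian \<phi> (p s) i j))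
       = (\<Sum>i\<in>Basis. \<Sum>j\<in>Basis. (v \<bullet> i) * (v \<bullet> j) * hessian \<phi> (p s) i j)"
      by (subst sum.swap) (simp add: sum_distrib_left mult_ac)
    finally have "((\<lambda>s. \<Sum>j\<in>Basis. (v \<bullet> j) * iter_pderiv \<phi> [j] (p s)) has_real_derivative
        (\<Sum>i\<in>Basis. \<Sum>j\<in>Basis. (v \<bullet> i) * (v \<bullet> j) * hessian \<phi> (p s) i j)) (at s)" .
    moreover have "((\<lambda>s. p s \<bullet> v) has_real_derivative v \<bullet> v) (at s)"
      unfolding has_field_derivative_def
      by (rule has_derivative_eq_rhs[OF has_derivative_inner_left[OF dp]]) auto
    ultimately show "(f' has_real_derivative f'' s) (at s)"
      unfolding f'_def[abs_def] f''_def by (intro DERIV_diff DERIV_cmult)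
    show "0 \<le> f'' s"
      using m[OF p_in[OF s], of v] by (simp add: f''_def power2_norm_eq_inner)
  qed simp
  then have "f ((1 - t) *\<^sub>R 0 + t *\<^sub>R 1) \<le> (1 - t) * f 0 + t * f 1"
    using t by (intro convex_onD) auto
  moreover have "p 0 = x" "p 1 = y" "p t = (1 - t) *\<^sub>R x + t *\<^sub>R y"
    by (simp_all add: p_def v_def algebra_simps)
  ultimately show "\<phi> ((1 - t) *\<^sub>R x + t *\<^sub>R y) - m / 2 * (norm ((1 - t) *\<^sub>R x + t *\<^sub>R y))\<^sup>2
      \<le> (1 - t) * (\<phi> x - m / 2 * (norm x)\<^sup>2) + t * (\<phi> y - m / 2 * (norm y)\<^sup>2)"
    by (simp add: f_def power2_norm_eq_inner)
qed

text \<open>The Hessian form is continuous, so it has a positive minimum on the compact product of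
  \<open>K\<close> with the unit sphere; homogeneity of degree two extends the bound to all
  \<open>v\<close>.\<close>

lemma hessian_posdef_uniform:
  fixes \<phi> :: "'a::euclidean_space \<Rightarrow> real"
  assumes V: "smooth_on V \<phi>" and pd: "\<And>x. x \<in> V \<Longrightarrow> hessian_posdef \<phi> x"
    and K: "compact K" "K \<subseteq> V"
  obtains m where "0 < m"
    "\<And>x v. x \<in> K \<Longrightarrow> m * (norm v)\<^sup>2 \<le> (\<Sum>i\<in>Basis. \<Sum>j\<in>Basis. (v \<bullet> i) * (v \<bullet> j) * hessian \<phi> x i j)"
proof -
  define q where "q = (\<lambda>(x, v). \<Sum>i\<in>Basis. \<Sum>j\<in>Basis. (v \<bullet> i) * (v \<bullet> j) * hessian \<phi> x i j)"
  define S where "S = K \<times> sphere (0::'a) 1"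
  show ?thesis
  proof (cases "K = {}")
    case True
    then show ?thesis using that[of 1] by auto
  next
    case False
    have "sphere (0::'a) 1 \<noteq> {}" by simp
    with False have ne: "S \<noteq> {}" by (simp add: S_def)
    have cH: "continuous_on S (\<lambda>z. hessian \<phi> (fst z) i j)" if "i \<in> Basis" "j \<in> Basis" for i j
    proof -
      have "continuous_on K (iter_pderiv \<phi> [i, j])"
        using smooth_on_continuous_on_iter_pderiv[OF V, of "[i, j]"] that K by (auto intro: continuous_on_subset)
      then have "continuous_on S (\<lambda>z. iter_pderiv \<phi> [i, j] (fst z))"
        by (rule continuous_on_compose2) (auto simp: S_def intro!: continuous_intros)
      then show ?thesis by (simp add: hessian_def)
    qed
    have "compact S" unfolding S_def using K by (intro compact_Times) auto
    moreover have "continuous_on S q"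
      unfolding q_def case_prod_beta by (intro continuous_intros cH) auto
    ultimately obtain z where z: "z \<in> S" "\<And>y. y \<in> S \<Longrightarrow> q z \<le> q y"
      using continuous_attains_inf[OF _ ne] by blast
    have "0 < q z"
    proof -
      obtain a b where ab: "z = (a, b)" "a \<in> K" "norm b = 1"
        using z(1) unfolding S_def by (cases z) auto
      then have "b \<noteq> 0" "hessian_posdef \<phi> a"
        using pd K by auto
      then show ?thesis
        unfolding q_def hessian_posdef_def ab by simp
    qed
    moreover have "q z * (norm v)\<^sup>2 \<le> (\<Sum>i\<in>Basis. \<Sum>j\<in>Basis. (v \<bullet> i) * (v \<bullet> j) * hessian \<phi> x i j)" if x: "x \<in> K" for x v
    proof (cases "v = 0")
      case False
      define u where "u = v /\<^sub>R norm v"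
      have u: "v = norm v *\<^sub>R u" "norm u = 1" using False by (simp_all add: u_def)
      have "q z \<le> q (x, u)"
        using z(2)[of "(x, u)"] x u by (simp add: S_def)
      then have "q z * (norm v)\<^sup>2 \<le> q (x, u) * (norm v)\<^sup>2"
        by (intro mult_right_mono) auto
      also have "\<dots> = (\<Sum>i\<in>Basis. \<Sum>j\<in>Basis. (v \<bullet> i) * (v \<bullet> j) * hessian \<phi> x i j)"
        by (subst (2 3) u(1)) (simp add: q_def sum_distrib_left power2_eq_square mult_ac)
      finally show ?thesis .
    qed simp
    ultimately show ?thesis by (rule that)
  qed
qed

text \<open>Dilating a sublevel set about the minimiser by the factor \<open>r / s\<close> maps the level \<open>s\<close> into the
  level \<open>r\<close>, so the layer between them has small relative area; quadratic growth bounds the area itself.\<close>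

lemma emeasure_strongly_convex_layer:
  fixes F :: "'a::euclidean_space \<Rightarrow> real"
  assumes dim: "DIM('a) = 2" and D: "compact D" and F: "continuous_on D F" "convex_on D F"
    and c: "0 < c"
    and mid: "\<And>x y. x \<in> D \<Longrightarrow> y \<in> D \<Longrightarrow> F ((1/2) *\<^sub>R (x + y)) \<le> (F x + F y) / 2 - c * (norm (x - y))\<^sup>2"
    and ab: "a \<le> b"
  shows "emeasure lborel {x \<in> D. a < F x \<and> F x \<le> b} \<le> ennreal (pi / c * (b - a))"
proof (cases "D = {}")
  case False
  have cD: "convex D" using F(2) by (rule convex_on_imp_convex)
  obtain x0 where x0: "x0 \<in> D" "\<And>x. x \<in> D \<Longrightarrow> F x0 \<le> F x"
    using continuous_attains_inf[OF D False F(1)] by blast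
  \<comment> \<open>The midpoint of \<open>x\<close> and the minimiser \<open>x0\<close> lies in
    \<open>D\<close>, so its value is at least \<open>F x0\<close>; solving the midpoint inequality
    for \<open>F x - F x0\<close> doubles the constant.\<close>
  have growth: "2 * c * (norm (x - x0))\<^sup>2 \<le> F x - F x0" if "x \<in> D" for x
  proof -
    have "(1/2) *\<^sub>R (x + x0) \<in> D"
      using convexD_alt[OF cD that x0(1), of "1/2"] by (simp add: scaleR_add_right)
    with x0(2) mid[OF that x0(1)] have "F x0 \<le> (F x + F x0) / 2 - c * (norm (x - x0))\<^sup>2"
      by force
    then show ?thesis by (simp add: field_simps)
  qed
  define A where "A s = {x \<in> D. F x \<le> F x0 + s}" for s
  have A_compact: "compact (A s)" for s
  proof -
    have "A s = D \<inter> F -` {..F x0 + s}" by (auto simp: A_def)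
    then have "closed (A s)"
      using continuous_closed_preimage[OF F(1) compact_imp_closed[OF D], of "{..F x0 + s}"] by simp
    then show ?thesis
      using D compact_Int_closed[of D "A s"] by (simp add: A_def Int_absorb1 subset_eq inf.absorb2)
  qed
  have A_borel: "A s \<in> sets borel" for s
    using A_compact by (intro borel_compact)
  have A_lm: "A s \<in> lmeasurable" for s
    using A_compact by (rule lmeasurable_compact)
  \<comment> \<open>By \<open>growth\<close>, \<open>A s\<close> lies in a disc of squared radius
    \<open>s / (2 * c)\<close>; dimension two makes the area linear in \<open>s\<close>.\<close>
  have mA: "measure lebesgue (A s) \<le> pi / (2 * c) * s" if s: "0 \<le> s" for s
  proof -
    have "A s \<subseteq> cball x0 (sqrt (s / (2 * c)))"
    proof
      fix x assume x: "x \<in> A s"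
      then have "2 * c * (norm (x - x0))\<^sup>2 \<le> s"
        using growth[of x] by (auto simp: A_def)
      then have "(norm (x - x0))\<^sup>2 \<le> s / (2 * c)"
        using c by (simp add: field_simps)
      then have "norm (x - x0) \<le> sqrt (s / (2 * c))"
        by (rule real_le_rsqrt)
      then show "x \<in> cball x0 (sqrt (s / (2 * c)))"
        by (simp add: dist_norm norm_minus_commute)
    qed
    then have "measure lebesgue (A s) \<le> measure lebesgue (cball x0 (sqrt (s / (2 * c))))"
      using A_lm by (intro measure_mono_fmeasurable) auto
    also have "\<dots> = pi / (2 * c) * s"
      using s c by (simp add: content_cball dim unit_ball_vol_2)
    finally show ?thesis .
  qed
  \<comment> \<open>Convexity with the minimiser as one end point shows that contraction by
    \<open>r / s\<close> lowers the height above the minimum from \<open>s\<close> to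
    \<open>r\<close>; areas in the plane scale by the square.\<close>
  have shrink: "(r / s)\<^sup>2 * measure lebesgue (A s) \<le> measure lebesgue (A r)" if rs: "0 \<le> r" "r \<le> s" "0 < s" for r s
  proof -
    define l where "l = r / s"
    have l: "0 \<le> l" "l \<le> 1" using rs by (auto simp: l_def)
    have "(\<lambda>x. l *\<^sub>R x + (1 - l) *\<^sub>R x0) ` A s \<subseteq> A r"
    proof safe
      fix x assume x: "x \<in> A s"
      then have xD: "x \<in> D" "F x \<le> F x0 + s" by (auto simp: A_def)
      have "(1 - l) *\<^sub>R x0 + l *\<^sub>R x \<in> D"
        using convexD_alt[OF cD x0(1) xD(1)] l by simp
      moreover have "F ((1 - l) *\<^sub>R x0 + l *\<^sub>R x) \<le> (1 - l) * F x0 + l * F x"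
        using convex_onD[OF F(2)] l x0(1) xD(1) by simp
      moreover have "l * F x \<le> l * (F x0 + s)"
        using xD(2) l by (intro mult_left_mono) auto
      moreover have "l * s = r" using rs by (simp add: l_def)
      ultimately show "l *\<^sub>R x + (1 - l) *\<^sub>R x0 \<in> A r"
        by (simp add: A_def algebra_simps)
    qed
    moreover have "(\<lambda>x. l *\<^sub>R x + (1 - l) *\<^sub>R x0) ` A s \<in> lmeasurable"
      using A_compact[of s] by (intro lmeasurable_compact compact_continuous_image continuous_intros) auto
    ultimately have "measure lebesgue ((\<lambda>x. l *\<^sub>R x + (1 - l) *\<^sub>R x0) ` A s) \<le> measure lebesgue (A r)"
      using A_lm by (intro measure_mono_fmeasurable) auto
    then show ?thesis
      by (simp add: measure_lebesgue_affine dim l_def power_divide abs_power2 power_abs[symmetric])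
  qed
  let ?L = "{x \<in> D. a < F x \<and> F x \<le> b}"
  define s where "s = b - F x0"
  define r where "r = a - F x0"
  have L: "?L = A s - A r" by (auto simp: A_def s_def r_def)
  have rs: "r \<le> s" using ab by (simp add: r_def s_def)
  have L_lm: "?L \<in> lmeasurable" unfolding L using A_lm by auto
  have "measure lebesgue ?L \<le> pi / c * (s - r)"
  proof (cases "s \<le> 0")
    case True
    \<comment> \<open>When \<open>b\<close> is at most the minimum, the layer contains at most
      minimisers, and \<open>A 0\<close> has measure zero by \<open>mA\<close>.\<close>
    have "?L = {} \<or> ?L \<subseteq> A 0"
      using True by (auto simp: A_def s_def)
    then have "measure lebesgue ?L \<le> measure lebesgue (A 0)"
      using A_lm L_lm by (auto intro!: measure_mono_fmeasurable)
    then show ?thesis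
      using mA[of 0] rs c by (simp add: order_trans[of _ 0])
  next
    case s: False
    show ?thesis
    proof (cases "r < 0")
      case True
      have "measure lebesgue ?L \<le> measure lebesgue (A s)"
        unfolding L using A_lm by (intro measure_mono_fmeasurable) auto
      also have "\<dots> \<le> pi / (2 * c) * s" using mA s by simp
      also have "\<dots> \<le> pi / c * (s - r)"
        using c s True pi_gt_zero by (simp add: field_simps add_increasing2 mult_nonpos_nonneg)
      finally show ?thesis .
    next
      case False
      then have "A r \<subseteq> A s" using rs by (auto simp: A_def)
      then have "measure lebesgue ?L = measure lebesgue (A s) - measure lebesgue (A r)"
        unfolding L using A_lm by (intro measurable_measure_Diff) (auto simp: fmeasurableD)
      also have "\<dots> \<le> measure lebesgue (A s) - (r / s)\<^sup>2 * measure lebesgue (A s)"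
        using shrink[of r s] False rs s by simp
      also have "\<dots> = (1 - (r / s)\<^sup>2) * measure lebesgue (A s)"
        by (simp add: algebra_simps)
      \<comment> \<open>With \<open>l = r / s\<close>, \<open>1 - l^2 \<le> 2 * (1 - l)\<close>. The
        factor \<open>s\<close> in the area bound turns the relative width \<open>1 - l\<close> into
        \<open>s - r\<close>, and the 2 cancels against \<open>2 * c\<close>.\<close>
      also have "\<dots> \<le> (2 * (1 - r / s)) * (pi / (2 * c) * s)"
      proof (rule mult_mono)
        have "0 \<le> (1 - r / s)\<^sup>2" by simp
        then show "1 - (r / s)\<^sup>2 \<le> 2 * (1 - r / s)"
          by (simp add: power2_eq_square algebra_simps)
        show "measure lebesgue (A s) \<le> pi / (2 * c) * s" using mA s by simp
        show "0 \<le> 2 * (1 - r / s)" using rs s by (simp add: field_simps)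
      qed simp
      also have "\<dots> = pi / c * (s - r)"
        using s c by (simp add: field_simps)
      finally show ?thesis .
    qed
  qed
  moreover have "emeasure lborel ?L = ennreal (measure lebesgue ?L)"
  proof -
    have "?L \<in> sets borel" unfolding L using A_borel by auto
    then have "emeasure lborel ?L = emeasure lebesgue ?L" by simp
    then show ?thesis using L_lm by (simp add: emeasure_eq_measure2)
  qed
  ultimately show ?thesis
    by (simp add: r_def s_def ennreal_leI)
qed (use ab c in auto)

section \<open>The measure of sums of two points of the surface\<close>

text \<open>The hypothesis only concerns intervals; a Borel set is covered by countably many closed
  intervals with disjoint interiors and nearly the same total length.\<close>

lemma emeasure_le_lborel_of_intervals:
  fixes M :: "real measure"
  assumes M[simp, measurable_cong]: "sets M = sets borel" and C: "0 \<le> C"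
    and le: "\<And>a b. a \<le> b \<Longrightarrow> emeasure M {a<..b} \<le> ennreal (C * (b - a))"
    and A: "A \<in> sets borel"
  shows "emeasure M A \<le> ennreal C * emeasure lborel A"
proof -
  \<comment> \<open>Enlarging the interval to the left by \<open>\<delta>\<close> makes it half-open
    at the cost of \<open>C * \<delta> \<le> e\<close>; dividing \<open>e\<close> by
    \<open>C + 1\<close> covers \<open>C = 0\<close>.\<close>
  have cl: "emeasure M {c..d} \<le> ennreal (C * (d - c))" if "c \<le> d" for c d
  proof (rule ennreal_le_epsilon)
    fix e :: real assume e: "0 < e"
    define \<delta> where "\<delta> = e / (C + 1)"
    have \<delta>: "0 < \<delta>" "C * \<delta> \<le> e" using C e by (simp_all add: \<delta>_def field_simps)
    have "emeasure M {c..d} \<le> emeasure M {c - \<delta><..d}"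
      using \<delta> by (intro emeasure_mono) auto
    also have "\<dots> \<le> ennreal (C * (d - (c - \<delta>)))"
      using that \<delta> by (intro le) auto
    also have "\<dots> \<le> ennreal (C * (d - c) + e)"
      using \<delta> by (intro ennreal_leI) (simp add: algebra_simps)
    also have "\<dots> = ennreal (C * (d - c)) + ennreal e"
      using that C e by (intro ennreal_plus) auto
    finally show "emeasure M {c..d} \<le> ennreal (C * (d - c)) + ennreal e" .
  qed
  have bdd: "emeasure M A \<le> ennreal C * emeasure lborel A"
    if A: "A \<in> sets borel" and sub: "A \<subseteq> cbox a b" for A a b
  proof (rule ennreal_le_epsilon)
    fix e :: real assume e: "0 < e"
    define \<delta> where "\<delta> = e / (C + 1)"
    have \<delta>: "0 < \<delta>" "C * \<delta> \<le> e" using C e by (simp_all add: \<delta>_def field_simps)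
    have Alm: "A \<in> lmeasurable"
      using A by (intro bounded_set_imp_lmeasurable bounded_subset[OF bounded_cbox sub]) auto
    obtain \<D> where D: "countable \<D>"
        "\<And>K. K \<in> \<D> \<Longrightarrow> K \<subseteq> cbox a b \<and> K \<noteq> {} \<and> (\<exists>c d. K = cbox c d)"
        "pairwise (\<lambda>A B. interior A \<inter> interior B = {}) \<D>"
        "A \<subseteq> \<Union>\<D>" "\<Union>\<D> \<in> lmeasurable" "measure lebesgue (\<Union>\<D>) \<le> measure lebesgue A + \<delta>"
      using measurable_outer_intervals_bounded[OF Alm sub \<delta>(1)] by metis
    \<comment> \<open>Passing to interiors keeps the length of an interval and makes the family
      disjoint, so that the lengths add up to the measure of the union.\<close>
    have K: "emeasure M K \<le> ennreal C * emeasure lborel (interior K)" "interior K \<in> sets borel" "K \<in> sets borel" if "K \<in> \<D>" for K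
    proof -
      obtain c d where cd: "K = cbox c d" "c \<le> d" using D(2)[OF \<open>K \<in> \<D>\<close>] by force
      then show "emeasure M K \<le> ennreal C * emeasure lborel (interior K)"
        using cl[of c d] C by (simp add: interior_cbox ennreal_mult'')
    qed (use D(2)[OF \<open>K \<in> \<D>\<close>] in auto)
    have "emeasure M A = (\<integral>\<^sup>+x. indicator A x \<partial>M)"
      using A by simp
    \<comment> \<open>The countable sum over the cover is written as an integral over counting
      measure, so that it can be exchanged with the integral over \<open>M\<close>.\<close>
    also have "\<dots> \<le> (\<integral>\<^sup>+x. (\<integral>\<^sup>+K. indicator K x \<partial>count_space \<D>) \<partial>M)"
    proof (rule nn_integral_mono)
      fix x
      show "indicator A x \<le> (\<integral>\<^sup>+K. indicator K x \<partial>count_space \<D>)"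
      proof (cases "x \<in> A")
        case True
        then obtain K where "K \<in> \<D>" "x \<in> K" using D(4) by auto
        then show ?thesis
          using nn_integral_ge_point[of K \<D> "\<lambda>K. indicator K x"] by (simp add: True)
      qed simp
    qed
    also have "\<dots> = (\<integral>\<^sup>+K. (\<integral>\<^sup>+x. indicator K x \<partial>M) \<partial>count_space \<D>)"
      using D(1) K(3) by (intro nn_integral_count_space_nn_integral) auto
    also have "\<dots> = (\<integral>\<^sup>+K. emeasure M K \<partial>count_space \<D>)"
      using K(3) by (intro nn_integral_cong) auto
    also have "\<dots> \<le> (\<integral>\<^sup>+K. ennreal C * emeasure lborel (interior K) \<partial>count_space \<D>)"
      using K(1) by (intro nn_integral_mono) simp
    also have "\<dots> = ennreal C * (\<integral>\<^sup>+K. emeasure lborel (interior K) \<partial>count_space \<D>)"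
      by (rule nn_integral_cmult) simp
    also have "(\<integral>\<^sup>+K. emeasure lborel (interior K) \<partial>count_space \<D>) = emeasure lborel (\<Union>K\<in>\<D>. interior K)"
      using D(1,3) K(2) by (intro emeasure_UN_countable[symmetric])
         (auto simp: disjoint_family_on_def pairwise_def)
    also have "\<dots> \<le> emeasure lebesgue (\<Union>\<D>)"
    proof -
      have "(\<Union>K\<in>\<D>. interior K) \<in> sets borel"
        by (intro borel_open open_UN) auto
      then have "emeasure lborel (\<Union>K\<in>\<D>. interior K) = emeasure lebesgue (\<Union>K\<in>\<D>. interior K)" by simp
      also have "\<dots> \<le> emeasure lebesgue (\<Union>\<D>)"
        using D(5) interior_subset by (intro emeasure_mono) (auto simp: fmeasurableD)
      finally show ?thesis .
    qed
    also have "emeasure lebesgue (\<Union>\<D>) = ennreal (measure lebesgue (\<Union>\<D>))"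
      using D(5) by (simp add: emeasure_eq_measure2)
    also have "\<dots> \<le> ennreal (measure lebesgue A + \<delta>)"
      using D(6) by (rule ennreal_leI)
    also have "\<dots> = emeasure lborel A + ennreal \<delta>"
      using Alm A \<delta> emeasure_eq_measure2[OF Alm] by (simp add: ennreal_plus)
    also have "ennreal C * (emeasure lborel A + ennreal \<delta>) = ennreal C * emeasure lborel A + ennreal (C * \<delta>)"
      using C \<delta> by (simp add: distrib_left ennreal_mult)
    also have "\<dots> \<le> ennreal C * emeasure lborel A + ennreal e"
      using \<delta> by (intro add_left_mono ennreal_leI)
    finally show "emeasure M A \<le> ennreal C * emeasure lborel A + ennreal e"
      by (simp add: mult_left_mono)
  qed
  \<comment> \<open>The covering step is for sets inside a box; continuity from below along growing
    boxes gives the general case.\<close>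
  define B where "B n = A \<inter> cbox (- real n) (real n)" for n
  have B: "B n \<in> sets borel" "incseq B" for n
    using A by (auto simp: B_def incseq_def)
  have "(\<Union>n. B n) = A"
  proof -
    have "\<exists>n. x \<in> cbox (- real n) (real n)" for x
    proof -
      obtain n where "\<bar>x\<bar> \<le> real n" using real_arch_simple by blast
      then show ?thesis by (intro exI[of _ n]) auto
    qed
    then show ?thesis by (auto simp: B_def)
  qed
  then have "emeasure M A = (SUP n. emeasure M (B n))"
    using SUP_emeasure_incseq[of B M] B by (auto simp: image_subset_iff)
  also have "\<dots> \<le> ennreal C * emeasure lborel A"
  proof (rule SUP_least)
    fix n
    have "emeasure M (B n) \<le> ennreal C * emeasure lborel (B n)"
      using B(1)[of n] by (intro bdd[of _ "- real n" "real n"]) (auto simp: B_def)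
    also have "\<dots> \<le> ennreal C * emeasure lborel A"
      using A by (intro mult_left_mono emeasure_mono) (auto simp: B_def)
    finally show "emeasure M (B n) \<le> ennreal C * emeasure lborel A" .
  qed
  finally show ?thesis .
qed

section \<open>Strong convexity of the sum function\<close>

text \<open>The squared norm satisfies the convexity inequality with exact defect
  \<open>t * (1 - t) * (norm (x - y))^2\<close>; convexity of the difference passes
  \<open>m / 2\<close> times this defect on to \<open>f\<close>.\<close>

lemma strong_convexityD:
  fixes f :: "'a::euclidean_space \<Rightarrow> real"
  assumes "convex_on K (\<lambda>x. f x - m / 2 * (norm x)\<^sup>2)" "x \<in> K" "y \<in> K" "0 \<le> t" "t \<le> 1"
  shows "f ((1 - t) *\<^sub>R x + t *\<^sub>R y) \<le> (1 - t) * f x + t * f y - m / 2 * (t * (1 - t)) * (norm (x - y))\<^sup>2"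
proof -
  have n: "(norm ((1 - t) *\<^sub>R x + t *\<^sub>R y))\<^sup>2 = (1 - t) * (norm x)\<^sup>2 + t * (norm y)\<^sup>2 - t * (1 - t) * (norm (x - y))\<^sup>2"
    by (simp add: power2_norm_eq_inner inner_add_left inner_add_right inner_diff_left inner_diff_right
        inner_commute[of y x] algebra_simps)
  have "f ((1 - t) *\<^sub>R x + t *\<^sub>R y) - m / 2 * (norm ((1 - t) *\<^sub>R x + t *\<^sub>R y))\<^sup>2
     \<le> (1 - t) * (f x - m / 2 * (norm x)\<^sup>2) + t * (f y - m / 2 * (norm y)\<^sup>2)"
    using convex_onD[OF assms(1)] assms(2-) by simp
  then show ?thesis unfolding n by (simp add: field_simps)
qed

text \<open>For two convex pieces \<open>K\<^sub>1\<close>, \<open>K\<^sub>2\<close> on which the Hessian of \<open>\<phi>\<close> is at least \<open>m\<close>, the function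
  \<open>\<xi> \<mapsto> \<phi> \<xi> + \<phi> (\<zeta> - \<xi>)\<close> is strongly convex on the convex set where \<open>\<xi> \<in> K\<^sub>1\<close> and
  \<open>\<zeta> - \<xi> \<in> K\<^sub>2\<close>, no matter how the two pieces lie relative to each other.\<close>

lemma emeasure_sum_layer_local:
  fixes \<phi> :: "'a::euclidean_space \<Rightarrow> real" and \<zeta> :: 'a
  assumes dim: "DIM('a) = 2" and m: "0 < m" and ab: "a \<le> b"
    and K: "compact K1" "compact K2" "continuous_on K1 \<phi>" "continuous_on K2 \<phi>"
      "convex_on K1 (\<lambda>x. \<phi> x - m / 2 * (norm x)\<^sup>2)" "convex_on K2 (\<lambda>x. \<phi> x - m / 2 * (norm x)\<^sup>2)"
  defines "L \<equiv> {\<xi>. \<xi> \<in> K1 \<and> \<zeta> - \<xi> \<in> K2 \<and> a < \<phi> \<xi> + \<phi> (\<zeta> - \<xi>) \<and> \<phi> \<xi> + \<phi> (\<zeta> - \<xi>) \<le> b}"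
  shows "L \<in> sets borel" and "emeasure lborel L \<le> ennreal (4 * pi / m * (b - a))"
proof -
  define D where "D = K1 \<inter> (\<lambda>x. \<zeta> - x) ` K2"
  define F where "F = (\<lambda>\<xi>. \<phi> \<xi> + \<phi> (\<zeta> - \<xi>))"
  have inD: "x \<in> D \<longleftrightarrow> x \<in> K1 \<and> \<zeta> - x \<in> K2" for x
    by (auto simp: D_def image_iff) (metis diff_diff_eq2 add_diff_cancel_left')
  have D: "compact D"
    unfolding D_def using K by (intro compact_Int compact_continuous_image continuous_intros)
  have F: "continuous_on D F"
    unfolding F_def
    by (intro continuous_intros continuous_on_subset[OF K(3)] continuous_on_compose2[OF K(4)]) (auto simp: inD)
  have cK: "convex K1" "convex K2" using K(5,6) by (auto dest: convex_on_imp_convex)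
  have cD: "convex D"
    unfolding convex_alt
  proof safe
    fix x y :: 'a and u :: real assume *: "x \<in> D" "y \<in> D" "0 \<le> u" "u \<le> 1"
    have "\<zeta> - ((1 - u) *\<^sub>R x + u *\<^sub>R y) = (1 - u) *\<^sub>R (\<zeta> - x) + u *\<^sub>R (\<zeta> - y)"
      by (simp add: algebra_simps)
    then show "(1 - u) *\<^sub>R x + u *\<^sub>R y \<in> D"
      using * cK unfolding inD convex_alt by auto
  qed
  \<comment> \<open>The reflection \<open>\<xi> \<mapsto> \<zeta> - \<xi>\<close> preserves
    distances, so both summands gain \<open>m / 2\<close> and the gains add up to
    \<open>m\<close>.\<close>
  have strong: "F ((1 - t) *\<^sub>R x + t *\<^sub>R y) \<le> (1 - t) * F x + t * F y - m * (t * (1 - t)) * (norm (x - y))\<^sup>2"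
    if xy: "x \<in> D" "y \<in> D" and t: "0 \<le> t" "t \<le> 1" for x y t
  proof -
    have e: "\<zeta> - ((1 - t) *\<^sub>R x + t *\<^sub>R y) = (1 - t) *\<^sub>R (\<zeta> - x) + t *\<^sub>R (\<zeta> - y)"
      by (simp add: algebra_simps)
    have n: "norm ((\<zeta> - x) - (\<zeta> - y)) = norm (x - y)"
      by (simp add: norm_minus_commute)
    have "\<phi> ((1 - t) *\<^sub>R x + t *\<^sub>R y) \<le> (1 - t) * \<phi> x + t * \<phi> y - m / 2 * (t * (1 - t)) * (norm (x - y))\<^sup>2"
      using xy t by (intro strong_convexityD[OF K(5)]) (auto simp: inD)
    moreover have "\<phi> (\<zeta> - ((1 - t) *\<^sub>R x + t *\<^sub>R y)) \<le> (1 - t) * \<phi> (\<zeta> - x) + t * \<phi> (\<zeta> - y) - m / 2 * (t * (1 - t)) * (norm (x - y))\<^sup>2"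
      unfolding e n[symmetric] using xy t by (intro strong_convexityD[OF K(6)]) (auto simp: inD)
    ultimately show ?thesis
      by (simp add: F_def field_simps)
  qed
  have Fc: "convex_on D F"
  proof (rule convex_onI[OF _ cD])
    fix t :: real and x y assume *: "0 < t" "t < 1" "x \<in> D" "y \<in> D"
    have "0 \<le> m * (t * (1 - t)) * (norm (x - y))\<^sup>2" using * m by simp
    with strong[of x y t] * show "F ((1 - t) *\<^sub>R x + t *\<^sub>R y) \<le> (1 - t) * F x + t * F y" by auto
  qed
  have L: "L = {x \<in> D. a < F x \<and> F x \<le> b}"
    by (auto simp: L_def inD F_def)
  \<comment> \<open>At \<open>t = 1/2\<close> the gain is \<open>m / 4\<close>, which becomes the
    \<open>c\<close> of the layer estimate.\<close>
  have "emeasure lborel {x \<in> D. a < F x \<and> F x \<le> b} \<le> ennreal (pi / (m / 4) * (b - a))"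
  proof (rule emeasure_strongly_convex_layer[OF dim D F Fc _ _ ab])
    fix x y assume "x \<in> D" "y \<in> D"
    from strong[OF this, of "1/2"] show "F ((1 / 2) *\<^sub>R (x + y)) \<le> (F x + F y) / 2 - m / 4 * (norm (x - y))\<^sup>2"
      by (simp add: scaleR_add_right field_simps)
  qed (use m in auto)
  then show "emeasure lborel L \<le> ennreal (4 * pi / m * (b - a))"
    by (simp add: L mult.commute)
  have "L = (D \<inter> F -` {..b}) - (D \<inter> F -` {..a})"
    by (auto simp: L)
  then show "L \<in> sets borel"
    using continuous_closed_preimage[OF F compact_imp_closed[OF D], of "{..b}"]
      continuous_closed_preimage[OF F compact_imp_closed[OF D], of "{..a}"] by auto
qed

text \<open>Segments between points of \<open>U\<close> may leave \<open>V\<close>, so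
  \<open>U\<close> is covered by finitely many closed balls inside \<open>V\<close>. Each pair of
  points of \<open>U\<close> lies in some pair of balls, and the local estimates are summed over the
  pairs; none of them depends on \<open>\<zeta>\<close>.\<close>

lemma emeasure_sum_layer:
  fixes \<phi> :: "'a::euclidean_space \<Rightarrow> real"
  assumes dim: "DIM('a) = 2" and U: "compact U" "U \<subseteq> V" and V: "open V" "smooth_on V \<phi>"
    and pd: "\<And>x. x \<in> V \<Longrightarrow> hessian_posdef \<phi> x"
  obtains C where "0 \<le> C"
    "\<And>\<zeta> a b. a \<le> b \<Longrightarrow> emeasure lborel {\<xi> \<in> U. \<zeta> - \<xi> \<in> U \<and> \<phi> \<xi> + \<phi> (\<zeta> - \<xi>) \<in> {a<..b}} \<le> ennreal (C * (b - a))"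
proof -
  have "\<forall>x\<in>U. \<exists>r>0. cball x r \<subseteq> V"
    using U V open_contains_cball by blast
  then obtain r where r: "\<And>x. x \<in> U \<Longrightarrow> 0 < r x" "\<And>x. x \<in> U \<Longrightarrow> cball x (r x) \<subseteq> V"
    by metis
  obtain T where T: "T \<subseteq> U" "finite T" "U \<subseteq> (\<Union>x\<in>T. ball x (r x))"
    using compactE_image[OF U(1), of U "\<lambda>x. ball x (r x)"] r(1)
    by (metis (no_types, lifting) UN_iff centre_in_ball open_ball subsetI)
  \<comment> \<open>The union of the balls is compact, which gives one lower Hessian bound
    \<open>m\<close> for all of them.\<close>
  define K where "K = (\<Union>x\<in>T. cball x (r x))"
  have K: "compact K" "K \<subseteq> V"
  proof -
    show "compact K" unfolding K_def using T by (intro compact_UN) auto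
    show "K \<subseteq> V" unfolding K_def using T r by blast
  qed
  obtain m where m: "0 < m"
    "\<And>x v. x \<in> K \<Longrightarrow> m * (norm v)\<^sup>2 \<le> (\<Sum>i\<in>Basis. \<Sum>j\<in>Basis. (v \<bullet> i) * (v \<bullet> j) * hessian \<phi> x i j)"
    using hessian_posdef_uniform[OF V(2) pd K] by blast
  define B where "B x = cball x (r x)" for x
  have B: "compact (B x)" "continuous_on (B x) \<phi>" "convex_on (B x) (\<lambda>x. \<phi> x - m / 2 * (norm x)\<^sup>2)" if "x \<in> T" for x
  proof -
    have s: "B x \<subseteq> K" using that by (auto simp: K_def B_def)
    show "compact (B x)" by (simp add: B_def)
    show "continuous_on (B x) \<phi>"
      using smooth_on_continuous_on_iter_pderiv[OF V(2), of "[]"] s K by (auto intro: continuous_on_subset)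
    show "convex_on (B x) (\<lambda>x. \<phi> x - m / 2 * (norm x)\<^sup>2)"
      using s K m by (intro convex_on_of_hessian_ge[OF V]) (auto simp: B_def)
  qed
  let ?C = "real (card (T \<times> T)) * (4 * pi / m)"
  show ?thesis
  proof
    show "0 \<le> ?C" using m by simp
    fix \<zeta> and a b :: real assume ab: "a \<le> b"
    define L where "L p = {\<xi>. \<xi> \<in> B (fst p) \<and> \<zeta> - \<xi> \<in> B (snd p) \<and> a < \<phi> \<xi> + \<phi> (\<zeta> - \<xi>) \<and> \<phi> \<xi> + \<phi> (\<zeta> - \<xi>) \<le> b}" for p
    have L: "L p \<in> sets borel" "emeasure lborel (L p) \<le> ennreal (4 * pi / m * (b - a))" if "p \<in> T \<times> T" for p
    proof -
      have p: "fst p \<in> T" "snd p \<in> T" using that by auto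
      note * = emeasure_sum_layer_local[OF dim m(1) ab B(1)[OF p(1)] B(1)[OF p(2)] B(2)[OF p(1)] B(2)[OF p(2)]
          B(3)[OF p(1)] B(3)[OF p(2)], of \<zeta>]
      show "L p \<in> sets borel" unfolding L_def by (rule *)
      show "emeasure lborel (L p) \<le> ennreal (4 * pi / m * (b - a))" unfolding L_def by (rule *)
    qed
    have "{\<xi> \<in> U. \<zeta> - \<xi> \<in> U \<and> \<phi> \<xi> + \<phi> (\<zeta> - \<xi>) \<in> {a<..b}} \<subseteq> (\<Union>p\<in>T \<times> T. L p)"
    proof safe
      fix \<xi> assume *: "\<xi> \<in> U" "\<zeta> - \<xi> \<in> U" "\<phi> \<xi> + \<phi> (\<zeta> - \<xi>) \<in> {a<..b}"
      obtain p where p: "p \<in> T" "\<xi> \<in> B p" using T(3) *(1) unfolding B_def by force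
      obtain q where q: "q \<in> T" "\<zeta> - \<xi> \<in> B q" using T(3) *(2) unfolding B_def by force
      show "\<xi> \<in> (\<Union>p\<in>T \<times> T. L p)"
        using p q *(3) by (intro UN_I[of "(p, q)"]) (auto simp: L_def)
    qed
    then have "emeasure lborel {\<xi> \<in> U. \<zeta> - \<xi> \<in> U \<and> \<phi> \<xi> + \<phi> (\<zeta> - \<xi>) \<in> {a<..b}} \<le> emeasure lborel (\<Union>p\<in>T \<times> T. L p)"
      using L T(2) by (intro emeasure_mono) (auto intro!: sets.finite_UN)
    also have "\<dots> \<le> (\<Sum>p\<in>T \<times> T. emeasure lborel (L p))"
      using L T(2) by (intro emeasure_subadditive_finite) auto
    also have "\<dots> \<le> (\<Sum>p\<in>T \<times> T. ennreal (4 * pi / m * (b - a)))"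
      by (intro sum_mono L)
    also have "\<dots> = ennreal (?C * (b - a))"
    proof -
      have "(\<Sum>p\<in>T \<times> T. ennreal (4 * pi / m * (b - a))) = ennreal (real (card (T \<times> T))) * ennreal (4 * pi / m * (b - a))"
        by (simp add: ennreal_of_nat_eq_real_of_nat)
      also have "\<dots> = ennreal (?C * (b - a))"
        using m ab by (subst ennreal_mult[symmetric]) (auto simp: mult.assoc)
      finally show ?thesis .
    qed
    finally show "emeasure lborel {\<xi> \<in> U. \<zeta> - \<xi> \<in> U \<and> \<phi> \<xi> + \<phi> (\<zeta> - \<xi>) \<in> {a<..b}} \<le> ennreal (?C * (b - a))" .
  qed
qed

text \<open>The shear \<open>(\<xi>, \<eta>) \<mapsto> (\<xi> + \<eta>, \<xi>)\<close> preserves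
  Lebesgue measure. After it, Fubini fixes \<open>\<zeta> = \<xi> + \<eta>\<close>, and only the
  one-dimensional image under \<open>\<xi> \<mapsto> P \<xi> + P (\<zeta> - \<xi>)\<close> has to be
  bounded; integration over \<open>\<zeta>\<close> restores the measure of \<open>E\<close>.\<close>

lemma emeasure_sum_pushforward_le:
  fixes P :: "'a::euclidean_space \<Rightarrow> real"
  assumes [measurable]: "P \<in> borel_measurable borel" "U \<in> sets borel" and C: "0 \<le> C"
    and layer: "\<And>\<zeta> a b. a \<le> b \<Longrightarrow> emeasure lborel {\<xi> \<in> U. \<zeta> - \<xi> \<in> U \<and> P \<xi> + P (\<zeta> - \<xi>) \<in> {a<..b}} \<le> ennreal (C * (b - a))"
    and E: "E \<in> sets (borel :: ('a \<times> real) measure)"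
  shows "emeasure (lborel \<Otimes>\<^sub>M lborel) {(\<xi>, \<eta>). \<xi> \<in> U \<and> \<eta> \<in> U \<and> (\<xi> + \<eta>, P \<xi> + P \<eta>) \<in> E} \<le> ennreal C * emeasure lborel E"
proof -
  have E'[measurable]: "E \<in> sets (borel \<Otimes>\<^sub>M borel)" by (subst borel_prod) (rule E)
  have slice: "emeasure lborel {\<xi> \<in> U. \<zeta> - \<xi> \<in> U \<and> P \<xi> + P (\<zeta> - \<xi>) \<in> A} \<le> ennreal C * emeasure lborel A"
    if [measurable]: "A \<in> sets borel" for \<zeta> A
  proof -
    define S where "S = {\<xi> \<in> U. \<zeta> - \<xi> \<in> U}"
    have [measurable]: "S \<in> sets borel" unfolding S_def by measurable
    \<comment> \<open>\<open>N\<close> is the distribution of heights on the slice;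
      \<open>layer\<close> is the interval hypothesis for it, which extends to Borel sets.\<close>
    define N where "N = distr (density lborel (indicator S)) borel (\<lambda>\<xi>. P \<xi> + P (\<zeta> - \<xi>))"
    have N: "emeasure N B = emeasure lborel {\<xi> \<in> U. \<zeta> - \<xi> \<in> U \<and> P \<xi> + P (\<zeta> - \<xi>) \<in> B}" if [measurable]: "B \<in> sets borel" for B
    proof -
      have "emeasure N B = emeasure (density lborel (indicator S)) ((\<lambda>\<xi>. P \<xi> + P (\<zeta> - \<xi>)) -` B)"
        unfolding N_def by (subst emeasure_distr) auto
      also have "\<dots> = (\<integral>\<^sup>+\<xi>. indicator S \<xi> * indicator ((\<lambda>\<xi>. P \<xi> + P (\<zeta> - \<xi>)) -` B) \<xi> \<partial>lborel)"
        by (rule emeasure_density) (use measurable_sets_borel[of "\<lambda>\<xi>. P \<xi> + P (\<zeta> - \<xi>)" borel B] in auto)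
      also have "\<dots> = (\<integral>\<^sup>+\<xi>. indicator {\<xi> \<in> U. \<zeta> - \<xi> \<in> U \<and> P \<xi> + P (\<zeta> - \<xi>) \<in> B} \<xi> \<partial>lborel)"
        by (intro nn_integral_cong) (auto simp: S_def split: split_indicator)
      also have "\<dots> = emeasure lborel {\<xi> \<in> U. \<zeta> - \<xi> \<in> U \<and> P \<xi> + P (\<zeta> - \<xi>) \<in> B}"
        by (intro nn_integral_indicator) measurable
      finally show ?thesis .
    qed
    have "emeasure N A \<le> ennreal C * emeasure lborel A"
    proof (rule emeasure_le_lborel_of_intervals[OF _ C])
      show "sets N = sets borel" by (simp add: N_def)
      show "emeasure N {a<..b} \<le> ennreal (C * (b - a))" if "a \<le> b" for a b
        using layer[OF that, of \<zeta>] by (subst N) simp_all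
    qed fact
    then show ?thesis by (simp add: N)
  qed
  let ?S = "{(\<xi>, \<eta>). \<xi> \<in> U \<and> \<eta> \<in> U \<and> (\<xi> + \<eta>, P \<xi> + P \<eta>) \<in> E}"
  let ?T = "{(\<zeta>, \<xi>). \<xi> \<in> U \<and> \<zeta> - \<xi> \<in> U \<and> (\<zeta>, P \<xi> + P (\<zeta> - \<xi>)) \<in> E}"
  have S[measurable]: "?S \<in> sets (lborel \<Otimes>\<^sub>M lborel)"
  proof -
    have "{p \<in> space (lborel \<Otimes>\<^sub>M lborel). fst p \<in> U \<and> snd p \<in> U \<and> (fst p + snd p, P (fst p) + P (snd p)) \<in> E} \<in> sets (lborel \<Otimes>\<^sub>M lborel)"
      by measurable
    then show ?thesis by (simp add: space_pair_measure case_prod_beta')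
  qed
  have T[measurable]: "?T \<in> sets (lborel \<Otimes>\<^sub>M lborel)"
  proof -
    have "{p \<in> space (lborel \<Otimes>\<^sub>M lborel). snd p \<in> U \<and> fst p - snd p \<in> U \<and> (fst p, P (snd p) + P (fst p - snd p)) \<in> E} \<in> sets (lborel \<Otimes>\<^sub>M lborel)"
      by measurable
    then show ?thesis by (simp add: space_pair_measure case_prod_beta')
  qed
  have "emeasure (lborel \<Otimes>\<^sub>M lborel) ?S = (\<integral>\<^sup>+\<xi>. \<integral>\<^sup>+\<eta>. indicator ?S (\<xi>, \<eta>) \<partial>lborel \<partial>lborel)"
    by (rule lborel.emeasure_pair_measure[OF S])
  also have "\<dots> = (\<integral>\<^sup>+\<xi>. \<integral>\<^sup>+\<zeta>. indicator ?S (\<xi>, \<zeta> - \<xi>) \<partial>lborel \<partial>lborel)"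
  proof (rule nn_integral_cong)
    fix \<xi> :: 'a
    have "(\<integral>\<^sup>+\<eta>. indicator ?S (\<xi>, \<eta>) \<partial>lborel) = (\<integral>\<^sup>+\<eta>. indicator ?S (\<xi>, \<eta>) \<partial>distr lborel borel ((+) (- \<xi>)))"
      by (simp add: lborel_distr_plus)
    also have "\<dots> = (\<integral>\<^sup>+\<zeta>. indicator ?S (\<xi>, - \<xi> + \<zeta>) \<partial>lborel)"
      by (intro nn_integral_distr) measurable
    finally show "(\<integral>\<^sup>+\<eta>. indicator ?S (\<xi>, \<eta>) \<partial>lborel) = (\<integral>\<^sup>+\<zeta>. indicator ?S (\<xi>, \<zeta> - \<xi>) \<partial>lborel)"
      by simp
  qed
  also have "\<dots> = (\<integral>\<^sup>+\<xi>. \<integral>\<^sup>+\<zeta>. indicator ?T (\<zeta>, \<xi>) \<partial>lborel \<partial>lborel)"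
    by (intro nn_integral_cong) (auto split: split_indicator)
  also have "\<dots> = (\<integral>\<^sup>+\<zeta>. \<integral>\<^sup>+\<xi>. indicator ?T (\<zeta>, \<xi>) \<partial>lborel \<partial>lborel)"
    by (rule lborel_pair.Fubini') measurable
  also have "\<dots> \<le> (\<integral>\<^sup>+\<zeta>. ennreal C * emeasure lborel (Pair \<zeta> -` E) \<partial>lborel)"
  proof (rule nn_integral_mono)
    fix \<zeta> :: 'a
    have [measurable]: "Pair \<zeta> -` E \<in> sets borel" using E' by (rule sets_Pair1)
    have "(\<integral>\<^sup>+\<xi>. indicator ?T (\<zeta>, \<xi>) \<partial>lborel) = (\<integral>\<^sup>+\<xi>. indicator {\<xi> \<in> U. \<zeta> - \<xi> \<in> U \<and> P \<xi> + P (\<zeta> - \<xi>) \<in> Pair \<zeta> -` E} \<xi> \<partial>lborel)"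
      by (intro nn_integral_cong) (auto split: split_indicator)
    also have "\<dots> = emeasure lborel {\<xi> \<in> U. \<zeta> - \<xi> \<in> U \<and> P \<xi> + P (\<zeta> - \<xi>) \<in> Pair \<zeta> -` E}"
      by (intro nn_integral_indicator) measurable
    also have "\<dots> \<le> ennreal C * emeasure lborel (Pair \<zeta> -` E)"
      by (rule slice) simp
    finally show "(\<integral>\<^sup>+\<xi>. indicator ?T (\<zeta>, \<xi>) \<partial>lborel) \<le> ennreal C * emeasure lborel (Pair \<zeta> -` E)" .
  qed
  also have "\<dots> = ennreal C * (\<integral>\<^sup>+\<zeta>. emeasure lborel (Pair \<zeta> -` E) \<partial>lborel)"
    by (intro nn_integral_cmult) measurable
  also have "(\<integral>\<^sup>+\<zeta>. emeasure lborel (Pair \<zeta> -` E) \<partial>lborel) = emeasure (lborel \<Otimes>\<^sub>M lborel) E"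
    by (intro lborel.emeasure_pair_measure_alt[symmetric]) simp
  finally show ?thesis by (simp add: lborel_prod)
qed

section \<open>Densities of dominated push-forwards\<close>

text \<open>Used with \<open>M\<close> Lebesgue measure on \<open>U \<times> U\<close> and
  \<open>\<Psi>\<close> the sum map. \<open>dom\<close> expresses that the push-forward of
  \<open>M\<close> has a density at most \<open>C\<close> without naming that density.\<close>

locale dominated_pushforward = finite_measure M for M :: "'x measure" +
  fixes \<Psi> :: "'x \<Rightarrow> 'y::euclidean_space" and C :: real
  assumes \<Psi>[measurable]: "\<Psi> \<in> borel_measurable M" and C: "0 < C"
    and dom: "\<And>E. E \<in> sets borel \<Longrightarrow> emeasure M (\<Psi> -` E \<inter> space M) \<le> ennreal C * emeasure lborel E"
begin

text \<open>By \<open>dom\<close> the push-forward of \<open>a\<close> times \<open>M\<close>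
  vanishes on Lebesgue null sets, so Radon--Nikodym applies; the density is finite almost everywhere
  because \<open>a\<close> is integrable.\<close>

lemma density_exists_nonneg:
  fixes a :: "'x \<Rightarrow> real"
  assumes a: "integrable M a" and nn: "\<And>x. 0 \<le> a x"
  obtains f :: "'y \<Rightarrow> real" where "integrable lborel f"
    "\<And>k :: 'y \<Rightarrow> complex. k \<in> borel_measurable borel \<Longrightarrow> (\<integral>x. a x * k (\<Psi> x) \<partial>M) = (\<integral>y. f y * k y \<partial>lborel)"
proof -
  have [measurable]: "a \<in> borel_measurable M" using a by auto
  define N where "N = distr (density M (\<lambda>x. ennreal (a x))) borel \<Psi>"
  have sN[simp, measurable_cong]: "sets N = sets borel" by (simp add: N_def)
  have "absolutely_continuous lborel N"
    unfolding absolutely_continuous_def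
  proof
    fix E :: "'y set" assume E: "E \<in> null_sets lborel"
    then have [measurable]: "E \<in> sets borel" by auto
    have "emeasure M (\<Psi> -` E \<inter> space M) = 0"
      using dom[of E] E by (auto simp: null_sets_def)
    then have n: "\<Psi> -` E \<inter> space M \<in> null_sets M" by (auto intro!: null_setsI)
    have "emeasure N E = emeasure (density M (\<lambda>x. ennreal (a x))) (\<Psi> -` E \<inter> space M)"
      unfolding N_def by (subst emeasure_distr) auto
    also have "\<dots> = 0"
      using absolutely_continuousI_density[of "\<lambda>x. ennreal (a x)" M] n
      unfolding absolutely_continuous_def by auto
    finally show "E \<in> null_sets N" by (auto intro!: null_setsI)
  qed
  then obtain g where g[measurable]: "g \<in> borel_measurable borel" and gN: "density lborel g = N"
    using sigma_finite_measure.Radon_Nikodym[OF sigma_finite_lborel, of N] by auto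
  have "(\<integral>\<^sup>+y. g y \<partial>lborel) = emeasure N UNIV"
    unfolding gN[symmetric] by (subst emeasure_density) auto
  also have "\<dots> = (\<integral>\<^sup>+x. ennreal (a x) \<partial>M)"
    unfolding N_def by (subst emeasure_distr) (auto simp: emeasure_density intro!: nn_integral_cong)
  also have "\<dots> < \<infinity>"
    using a nn by (simp add: nn_integral_eq_integral)
  finally have fin: "(\<integral>\<^sup>+y. g y \<partial>lborel) < \<infinity>" .
  then have gfin: "AE y in lborel. g y \<noteq> \<infinity>"
    by (intro nn_integral_PInf_AE) auto
  define f where "f y = enn2real (g y)" for y
  have fm[measurable]: "f \<in> borel_measurable borel" unfolding f_def by measurable
  have fg: "AE y in lborel. ennreal (f y) = g y"
    using gfin by eventually_elim (auto simp: f_def less_top)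
  have fN: "density lborel (\<lambda>y. ennreal (f y)) = N"
    unfolding gN[symmetric] using fg by (intro density_cong) auto
  show ?thesis
  proof
    have "(\<integral>\<^sup>+y. ennreal (f y) \<partial>lborel) = (\<integral>\<^sup>+y. g y \<partial>lborel)"
      using fg by (rule nn_integral_cong_AE)
    then show "integrable lborel f"
      using fin by (intro integrableI_nonneg) (auto simp: f_def)
    fix k :: "'y \<Rightarrow> complex" assume [measurable]: "k \<in> borel_measurable borel"
    have "(\<integral>x. a x * k (\<Psi> x) \<partial>M) = (\<integral>x. k (\<Psi> x) \<partial>density M (\<lambda>x. ennreal (a x)))"
      using nn by (subst integral_density) (auto simp: scaleR_conv_of_real)
    also have "\<dots> = (\<integral>y. k y \<partial>N)"
      unfolding N_def by (subst integral_distr) auto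
    also have "\<dots> = (\<integral>y. f y * k y \<partial>lborel)"
      unfolding fN[symmetric] by (subst integral_density) (auto simp: scaleR_conv_of_real f_def)
    finally show "(\<integral>x. a x * k (\<Psi> x) \<partial>M) = (\<integral>y. f y * k y \<partial>lborel)" .
  qed
qed

text \<open>Positive and negative parts of the real and imaginary part are treated separately;
  \<open>k\<close> is bounded here so that the four integrals exist and recombine.\<close>

lemma density_exists:
  fixes h :: "'x \<Rightarrow> complex"
  assumes h: "integrable M h"
  obtains f :: "'y \<Rightarrow> complex" where "integrable lborel f"
    "\<And>k B. k \<in> borel_measurable borel \<Longrightarrow> (\<And>y. norm (k y) \<le> B) \<Longrightarrow> (\<integral>x. h x * k (\<Psi> x) \<partial>M) = (\<integral>y. f y * k y \<partial>lborel)"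
proof -
  define a where "a i x = max 0 (if i = 0 then Re (h x) else if i = 1 then - Re (h x)
    else if i = 2 then Im (h x) else - Im (h x))" for i :: nat and x
  have ia: "integrable M (a i)" for i
    unfolding a_def using h by (cases "i = 0"; cases "i = 1"; cases "i = 2"; simp)
  define R where "R i f \<longleftrightarrow> integrable lborel f \<and> (\<forall>k :: 'y \<Rightarrow> complex. k \<in> borel_measurable borel \<longrightarrow>
      (\<integral>x. a i x * k (\<Psi> x) \<partial>M) = (\<integral>y. complex_of_real (f y) * k y \<partial>lborel))" for i f
  have "\<exists>f. R i f" for i
  proof -
    have nn: "0 \<le> a i x" for x by (simp add: a_def)
    obtain f :: "'y \<Rightarrow> real" where "integrable lborel f" "\<And>k :: 'y \<Rightarrow> complex. k \<in> borel_measurable borel \<Longrightarrow>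
        (\<integral>x. a i x * k (\<Psi> x) \<partial>M) = (\<integral>y. complex_of_real (f y) * k y \<partial>lborel)"
      using density_exists_nonneg[OF ia[of i] nn] by blast
    then have "R i f" unfolding R_def by blast
    then show ?thesis by (rule exI[where x=f])
  qed
  then obtain f where R: "R i (f i)" for i
    using choice[of R] by blast
  have f: "integrable lborel (f i)" "k \<in> borel_measurable borel \<Longrightarrow>
      (\<integral>x. a i x * k (\<Psi> x) \<partial>M) = (\<integral>y. complex_of_real (f i y) * k y \<partial>lborel)" for i and k :: "'y \<Rightarrow> complex"
    using R[of i] unfolding R_def by blast+
  have [measurable]: "f i \<in> borel_measurable borel" for i
    using f(1)[of i] by (auto dest: borel_measurable_integrable)
  have [measurable]: "a i \<in> borel_measurable M" for i
    using ia[of i] by auto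
  have ha: "h x = (of_real (a 0 x) - of_real (a 1 x)) + \<i> * (of_real (a 2 x) - of_real (a 3 x))" for x
    by (auto simp: a_def complex_eq_iff max_def)
  define F where "F y = (of_real (f 0 y) - of_real (f 1 y)) + \<i> * (of_real (f 2 y) - of_real (f 3 y))" for y
  show ?thesis
  proof
    show "integrable lborel F"
      unfolding F_def using f(1) by auto
    fix k :: "'y \<Rightarrow> complex" and B assume [measurable]: "k \<in> borel_measurable borel" and B: "\<And>y. norm (k y) \<le> B"
    have B0: "0 \<le> B" using B[of 0] norm_ge_zero order_trans by blast
    have i1: "integrable M (\<lambda>x. complex_of_real (a i x) * k (\<Psi> x))" for i
      by (rule Bochner_Integration.integrable_bound[OF integrable_mult_left[OF ia[of i], of B]])
         (auto simp: norm_mult abs_mult B0 intro!: AE_I2 mult_left_mono B)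
    have i2: "integrable lborel (\<lambda>y. complex_of_real (f i y) * k y)" for i
      by (rule Bochner_Integration.integrable_bound[OF integrable_mult_left[OF f(1)[of i], of B]])
         (auto simp: norm_mult abs_mult B0 intro!: AE_I2 mult_left_mono B)
    have "(\<integral>x. h x * k (\<Psi> x) \<partial>M) = (\<integral>x. (a 0 x * k (\<Psi> x) - a 1 x * k (\<Psi> x)) + \<i> * (a 2 x * k (\<Psi> x) - a 3 x * k (\<Psi> x)) \<partial>M)"
      by (intro Bochner_Integration.integral_cong refl, subst ha) (simp add: algebra_simps)
    also have "\<dots> = ((\<integral>x. a 0 x * k (\<Psi> x) \<partial>M) - (\<integral>x. a 1 x * k (\<Psi> x) \<partial>M)) + \<i> * ((\<integral>x. a 2 x * k (\<Psi> x) \<partial>M) - (\<integral>x. a 3 x * k (\<Psi> x) \<partial>M))"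
      using i1 by simp
    also have "\<dots> = ((\<integral>y. f 0 y * k y \<partial>lborel) - (\<integral>y. f 1 y * k y \<partial>lborel)) + \<i> * ((\<integral>y. f 2 y * k y \<partial>lborel) - (\<integral>y. f 3 y * k y \<partial>lborel))"
      by (simp add: f(2))
    also have "\<dots> = (\<integral>y. (f 0 y * k y - f 1 y * k y) + \<i> * (f 2 y * k y - f 3 y * k y) \<partial>lborel)"
      using i2 by simp
    also have "\<dots> = (\<integral>y. F y * k y \<partial>lborel)"
      by (intro Bochner_Integration.integral_cong refl) (simp add: F_def algebra_simps)
    finally show "(\<integral>x. h x * k (\<Psi> x) \<partial>M) = (\<integral>y. F y * k y \<partial>lborel)" .
  qed
qed

lemma integral_combination:
  fixes f g r :: "'z \<Rightarrow> real"
  assumes "integrable N f" "integrable N g" "integrable N r"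
  shows "(\<integral>x. c * f x + g x - 2 * r x \<partial>N) = c * (\<integral>x. f x \<partial>N) + (\<integral>x. g x \<partial>N) - 2 * (\<integral>x. r x \<partial>N)"
  using assms by simp

text \<open>A Cauchy--Schwarz inequality for the densities: \<open>2 Re (cnj w * f) \<le> C |w|\<^sup>2 + m\<close> almost
  everywhere for all \<open>w\<close> in a countable dense set, hence for all \<open>w\<close>; then take \<open>w = f / C\<close>.\<close>

lemma AE_density_square_le:
  fixes h :: "'x \<Rightarrow> complex"
  assumes h: "integrable M h" and h2: "integrable M (\<lambda>x. (norm (h x))\<^sup>2)"
    and f: "integrable lborel f"
      "\<And>k B. k \<in> borel_measurable borel \<Longrightarrow> (\<And>y. norm (k y) \<le> B) \<Longrightarrow> (\<integral>x. h x * k (\<Psi> x) \<partial>M) = (\<integral>y. f y * k y \<partial>lborel)"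
    and m: "integrable lborel m"
      "\<And>k :: 'y \<Rightarrow> complex. k \<in> borel_measurable borel \<Longrightarrow> (\<integral>x. complex_of_real ((norm (h x))\<^sup>2) * k (\<Psi> x) \<partial>M) = (\<integral>y. complex_of_real (m y) * k y \<partial>lborel)"
  shows "AE y in lborel. (norm (f y))\<^sup>2 \<le> C * m y"
proof -
  have [measurable]: "h \<in> borel_measurable M" "f \<in> borel_measurable borel" "m \<in> borel_measurable borel"
    using h f(1) m(1) by (auto dest: borel_measurable_integrable)
  \<comment> \<open>The integral of \<open>u w\<close> over a set dominates that of
    \<open>|w - h|^2\<close> over its preimage: \<open>C\<close> stands in for the density of the
    constant 1.\<close>
  define u where "u w y = C * (norm w)\<^sup>2 + m y - 2 * Re (cnj w * f y)" for w y
  have AE_u: "AE y in lborel. 0 \<le> u w y" for w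
  proof -
    \<comment> \<open>Constants are not integrable over the whole space, hence the cutoff to balls.
      Nonnegativity then follows from nonnegative integrals over all Borel sets.\<close>
    have "AE y in lborel. 0 \<le> indicator (cball 0 (real n)) y * u w y" for n
    proof (rule sigma_finite_measure.density_nonneg[OF sigma_finite_lborel])
      have fin: "emeasure lborel (A \<inter> cball 0 (real n)) < \<infinity>" for A :: "'y set"
        by (rule emeasure_bounded_finite) (meson bounded_Int bounded_cball)
      have iI: "integrable lborel (\<lambda>y. indicator (A \<inter> cball 0 (real n)) y :: real)" if "A \<in> sets borel" for A :: "'y set"
        using that fin by (auto simp: integrable_indicator_iff)
      have ifI: "integrable lborel (\<lambda>y. f y * indicator (A \<inter> cball 0 (real n)) y)" if "A \<in> sets borel" for A :: "'y set"
        using that by (intro Bochner_Integration.integrable_bound[OF f(1)]) (auto simp: norm_mult indicator_def)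
      have imI: "integrable lborel (\<lambda>y. m y * indicator (A \<inter> cball 0 (real n)) y)" if "A \<in> sets borel" for A :: "'y set"
        using that by (intro Bochner_Integration.integrable_bound[OF m(1)]) (auto simp: abs_mult indicator_def)
      have u: "indicator A y * (indicator (cball 0 (real n)) y * u w y) = 
          C * (norm w)\<^sup>2 * indicator (A \<inter> cball 0 (real n)) y + m y * indicator (A \<inter> cball 0 (real n)) y
           - 2 * Re (cnj w * (f y * indicator (A \<inter> cball 0 (real n)) y))" for A y
        by (simp add: u_def split: split_indicator)
      have iu: "integrable lborel (\<lambda>y. indicator A y * (indicator (cball 0 (real n)) y * u w y))" if "A \<in> sets borel" for A :: "'y set"
        unfolding u
        by (intro Bochner_Integration.integrable_diff Bochner_Integration.integrable_add integrable_mult_right integrable_Re iI ifI imI that)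
      from iu[of UNIV] show "integrable lborel (\<lambda>y. indicator (cball 0 (real n)) y * u w y)" by simp
      fix A :: "'y set" assume "A \<in> sets lborel"
      then have A[measurable]: "A \<in> sets borel" by simp
      define D where "D = A \<inter> cball 0 (real n)"
      have [measurable]: "D \<in> sets borel" by (simp add: D_def)
      have MD: "C * measure lborel D \<ge> measure M (\<Psi> -` D \<inter> space M)"
      proof -
        have "ennreal (measure M (\<Psi> -` D \<inter> space M)) \<le> ennreal C * emeasure lborel D"
          using dom[of D] by (simp add: emeasure_eq_measure)
        also have "\<dots> = ennreal (C * measure lborel D)"
          using fin[of A] C by (simp add: D_def emeasure_eq_ennreal_measure less_top ennreal_mult)
        finally show ?thesis using C by (subst (asm) ennreal_le_iff) auto
      qed
      have fD: "(\<integral>y. f y * indicator D y \<partial>lborel) = (\<integral>x. h x * indicator D (\<Psi> x) \<partial>M)"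
        by (rule f(2)[of "indicator D" 1, symmetric]) (auto split: split_indicator)
      have "complex_of_real (\<integral>y. m y * indicator D y \<partial>lborel) = (\<integral>y. complex_of_real (m y) * indicator D y \<partial>lborel)"
        by (subst integral_complex_of_real[symmetric]) (auto intro!: Bochner_Integration.integral_cong split: split_indicator)
      also have "\<dots> = (\<integral>x. complex_of_real ((norm (h x))\<^sup>2) * indicator D (\<Psi> x) \<partial>M)"
        by (rule m(2)[symmetric]) auto
      also have "\<dots> = complex_of_real (\<integral>x. (norm (h x))\<^sup>2 * indicator D (\<Psi> x) \<partial>M)"
        by (subst integral_complex_of_real[symmetric]) (auto intro!: Bochner_Integration.integral_cong split: split_indicator)
      finally have mD: "(\<integral>y. m y * indicator D y \<partial>lborel) = (\<integral>x. (norm (h x))\<^sup>2 * indicator D (\<Psi> x) \<partial>M)"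
        using of_real_eq_iff by blast
      have ih: "integrable M (\<lambda>x. h x * indicator D (\<Psi> x))"
        by (rule Bochner_Integration.integrable_bound[OF h]) (auto simp: norm_mult indicator_def)
      have ih2: "integrable M (\<lambda>x. (norm (h x))\<^sup>2 * indicator D (\<Psi> x))"
        by (rule Bochner_Integration.integrable_bound[OF h2]) (auto simp: indicator_def)
      have iD: "integrable M (\<lambda>x. indicator D (\<Psi> x) :: real)"
        by (rule integrable_const_bound[where B=1]) (auto simp: indicator_def)
      have ID: "(\<integral>x. indicator D (\<Psi> x) \<partial>M) = measure M (\<Psi> -` D \<inter> space M)"
        using Bochner_Integration.integral_indicator[of M "\<Psi> -` D"] by (simp add: indicator_vimage[abs_def] comp_def)
      have "0 \<le> (\<integral>x. (norm w)\<^sup>2 * indicator D (\<Psi> x) + (norm (h x))\<^sup>2 * indicator D (\<Psi> x) - 2 * Re (cnj w * (h x * indicator D (\<Psi> x))) \<partial>M)"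
      proof (rule integral_nonneg_AE, rule AE_I2)
        fix x
        have "0 \<le> (norm (w - h x))\<^sup>2" by simp
        also have "(norm (w - h x))\<^sup>2 = (norm w)\<^sup>2 + (norm (h x))\<^sup>2 - 2 * Re (cnj w * h x)"
          unfolding cmod_power2 by (simp add: power2_eq_square algebra_simps)
        finally show "0 \<le> (norm w)\<^sup>2 * indicator D (\<Psi> x) + (norm (h x))\<^sup>2 * indicator D (\<Psi> x) - 2 * Re (cnj w * (h x * indicator D (\<Psi> x)))"
          by (auto split: split_indicator)
      qed
      also have "\<dots> = (norm w)\<^sup>2 * measure M (\<Psi> -` D \<inter> space M) + (\<integral>x. (norm (h x))\<^sup>2 * indicator D (\<Psi> x) \<partial>M)
           - 2 * Re (cnj w * (\<integral>x. h x * indicator D (\<Psi> x) \<partial>M))"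
      proof -
        have "(\<integral>x. Re (cnj w * (h x * indicator D (\<Psi> x))) \<partial>M) = Re (\<integral>x. cnj w * (h x * indicator D (\<Psi> x)) \<partial>M)"
          using ih by (intro Bochner_Integration.integral_Re integrable_mult_right)
        also have "\<dots> = Re (cnj w * (\<integral>x. h x * indicator D (\<Psi> x) \<partial>M))"
          by (simp only: integral_mult_right_zero)
        finally have R: "(\<integral>x. Re (cnj w * (h x * indicator D (\<Psi> x))) \<partial>M) = Re (cnj w * (\<integral>x. h x * indicator D (\<Psi> x) \<partial>M))" .
        show ?thesis
          unfolding ID[symmetric] R[symmetric]
          by (intro integral_combination iD ih2 integrable_Re integrable_mult_right ih)
      qed
      also have "\<dots> \<le> (norm w)\<^sup>2 * (C * measure lborel D) + (\<integral>x. (norm (h x))\<^sup>2 * indicator D (\<Psi> x) \<partial>M)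
           - 2 * Re (cnj w * (\<integral>x. h x * indicator D (\<Psi> x) \<partial>M))"
        using MD by (auto intro!: mult_left_mono)
      also have "\<dots> = (\<integral>y. indicator A y * (indicator (cball 0 (real n)) y * u w y) \<partial>lborel)"
      proof -
        have "(\<integral>y. Re (cnj w * (f y * indicator D y)) \<partial>lborel) = Re (\<integral>y. cnj w * (f y * indicator D y) \<partial>lborel)"
          using ifI[OF A] by (intro Bochner_Integration.integral_Re integrable_mult_right) (simp add: D_def)
        also have "\<dots> = Re (cnj w * (\<integral>y. f y * indicator D y \<partial>lborel))"
          by (simp only: integral_mult_right_zero)
        finally have 1: "(\<integral>y. Re (cnj w * (f y * indicator D y)) \<partial>lborel) = Re (cnj w * (\<integral>y. f y * indicator D y \<partial>lborel))" .
        have 2: "integrable lborel (\<lambda>y. Re (cnj w * (f y * indicator D y)))"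
          using ifI[OF A] by (intro integrable_Re integrable_mult_right) (simp add: D_def)
        have "(\<integral>y. indicator A y * (indicator (cball 0 (real n)) y * u w y) \<partial>lborel) =
           (\<integral>y. C * (norm w)\<^sup>2 * indicator D y + m y * indicator D y - 2 * Re (cnj w * (f y * indicator D y)) \<partial>lborel)"
          unfolding u D_def ..
        also have "\<dots> = C * (norm w)\<^sup>2 * measure lborel D + (\<integral>y. m y * indicator D y \<partial>lborel) - 2 * (\<integral>y. Re (cnj w * (f y * indicator D y)) \<partial>lborel)"
          using integral_combination[OF iI[OF A] imI[OF A] 2[unfolded D_def], of "C * (norm w)\<^sup>2"]
          by (simp only: D_def[symmetric] Bochner_Integration.integral_indicator) simp
        finally show ?thesis
          unfolding 1 fD mD by simp
      qed
      finally show "0 \<le> set_lebesgue_integral lborel A (\<lambda>y. indicator (cball 0 (real n)) y * u w y)"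
        by (simp add: set_lebesgue_integral_def)
    qed
    then have "AE y in lborel. \<forall>n. 0 \<le> indicator (cball 0 (real n)) y * u w y"
      by (subst AE_all_countable) auto
    then show ?thesis
    proof eventually_elim
      case (elim y)
      obtain n where "norm y \<le> real n" using real_arch_simple by blast
      then show ?case using elim[rule_format, of n] by simp
    qed
  qed
  \<comment> \<open>Each \<open>w\<close> brings its own null set; countability keeps their union
    null, and continuity of \<open>u w y\<close> in \<open>w\<close> passes from the dense set to
    all \<open>w\<close>.\<close>
  obtain W :: "complex set" where W: "countable W" "\<And>X. open X \<Longrightarrow> X \<noteq> {} \<Longrightarrow> \<exists>d\<in>W. d \<in> X"
    using countable_dense_exists by metis
  have "AE y in lborel. \<forall>w\<in>W. 0 \<le> u w y"
    using AE_u by (subst AE_ball_countable[OF W(1)]) auto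
  then show ?thesis
  proof eventually_elim
    case (elim y)
    have "0 \<le> u w y" for w
    proof (rule ccontr)
      assume "\<not> 0 \<le> u w y"
      then have "w \<in> {w. u w y < 0}" by simp
      then have "{w. u w y < 0} \<noteq> {}" by blast
      moreover have "open {w. u w y < 0}"
        unfolding u_def by (intro open_Collect_less continuous_intros)
      ultimately show False using W(2) elim by force
    qed
    \<comment> \<open>This \<open>w\<close> minimises \<open>u w y\<close>, with minimum
      \<open>m y - (norm (f y))^2 / C\<close>.\<close>
    from this[of "f y / of_real C"]
    have "0 \<le> C * (norm (f y / of_real C))\<^sup>2 + m y - 2 * Re (cnj (f y / of_real C) * f y)"
      unfolding u_def .
    also have "Re (cnj (f y / of_real C) * f y) = (norm (f y))\<^sup>2 / C"
      unfolding cmod_power2 by (simp add: power2_eq_square add_divide_distrib)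
    also have "C * (norm (f y / of_real C))\<^sup>2 = (norm (f y))\<^sup>2 / C"
      using C by (simp add: norm_divide power_divide power2_eq_square)
    finally show "(norm (f y))\<^sup>2 \<le> C * m y"
      using C by (simp add: field_simps)
  qed
qed

end

section \<open>Laplace transforms and the extension operator\<close>

text \<open>\<open>exp (b - a) \<ge> 1 + (b - a)\<close> gives one side and symmetry the other. The
  bound dominates difference quotients of \<open>exp (- t * T y)\<close> uniformly in
  \<open>y\<close>.\<close>

lemma abs_exp_diff_le:
  fixes a b :: real
  assumes "\<bar>a\<bar> \<le> K" "\<bar>b\<bar> \<le> K"
  shows "\<bar>exp a - exp b\<bar> \<le> \<bar>a - b\<bar> * exp K"
proof -
  have *: "exp a - exp b \<le> \<bar>a - b\<bar> * exp K" if "\<bar>a\<bar> \<le> K" "\<bar>b\<bar> \<le> K" for a b :: real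
  proof -
    have "exp a * (1 + (b - a)) \<le> exp a * exp (b - a)"
      by (intro mult_left_mono exp_ge_add_one_self) simp
    then have "exp a - exp b \<le> exp a * (a - b)"
      by (simp add: exp_diff algebra_simps)
    also have "\<dots> \<le> exp K * \<bar>a - b\<bar>"
      using that by (intro order_trans[OF mult_left_mono[OF abs_ge_self] mult_right_mono]) auto
    finally show ?thesis by (simp add: mult.commute)
  qed
  show ?thesis
    using *[OF assms] *[OF assms(2,1)] by (simp add: abs_le_iff abs_minus_commute)
qed

text \<open>Because \<open>T\<close> is bounded, difference quotients along any null sequence are
  dominated by a multiple of \<open>|v|\<close>. This works at every real \<open>t\<close>, so
  derivatives can be iterated as functions on the whole line.\<close>

lemma laplace_has_derivative:
  fixes v T :: "'y \<Rightarrow> real"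
  assumes v: "integrable M v" and [measurable]: "T \<in> borel_measurable M"
    and T: "\<And>y. 0 \<le> T y" "\<And>y. T y \<le> B"
  shows "((\<lambda>t. \<integral>y. exp (- t * T y) * v y \<partial>M) has_real_derivative (\<integral>y. - T y * exp (- t * T y) * v y \<partial>M)) (at t)"
proof -
  have B: "0 \<le> B" using T[of undefined] by linarith
  have [measurable]: "v \<in> borel_measurable M" using v by auto
  have int: "integrable M (\<lambda>y. exp (- t * T y) * v y)" for t
  proof (rule Bochner_Integration.integrable_bound[OF integrable_mult_right[OF v, of "exp (\<bar>t\<bar> * B)"]])
    have "exp (- t * T y) \<le> exp (\<bar>t\<bar> * B)" for y
      using mult_mono[of "- t" "\<bar>t\<bar>" "T y" B] T[of y] by auto
    then show "AE y in M. norm (exp (- t * T y) * v y) \<le> norm (exp (\<bar>t\<bar> * B) * v y)"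
      by (auto simp: abs_mult intro!: mult_right_mono)
  qed auto
  show ?thesis
    unfolding DERIV_def tendsto_at_iff_sequentially comp_def
  proof (intro allI impI)
    fix X :: "nat \<Rightarrow> real" assume X0: "\<forall>i. X i \<in> UNIV - {0}" and X: "X \<longlonglongrightarrow> 0"
    have X0': "X i \<noteq> 0" for i using X0 by auto
    obtain K where K: "\<And>i. \<bar>X i\<bar> \<le> K"
      using convergent_imp_Bseq[of X] X by (auto simp: Bseq_def convergent_def)
    \<comment> \<open>\<open>L\<close> bounds all exponents that occur at \<open>t\<close> and at
      the points \<open>t + X i\<close>.\<close>
    define L where "L = (\<bar>t\<bar> + K) * B"
    have le: "\<bar>- s * T y\<bar> \<le> L" if "\<bar>s\<bar> \<le> \<bar>t\<bar> + K" for s y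
      using mult_mono[OF that, of "T y" B] T[of y] that by (simp add: L_def abs_mult)
    have K0: "0 \<le> K" using K[of 0] by linarith
    have "(\<lambda>i. \<integral>y. (exp (- (t + X i) * T y) - exp (- t * T y)) / X i * v y \<partial>M)
        \<longlonglongrightarrow> (\<integral>y. - T y * exp (- t * T y) * v y \<partial>M)"
    proof (rule integral_dominated_convergence[where w="\<lambda>y. B * exp L * \<bar>v y\<bar>"])
      show "AE y in M. (\<lambda>i. (exp (- (t + X i) * T y) - exp (- t * T y)) / X i * v y) \<longlonglongrightarrow> - T y * exp (- t * T y) * v y"
      proof (rule AE_I2)
        fix y
        have "((\<lambda>t. exp (- t * T y)) has_real_derivative exp (- t * T y) * - T y) (at t)"
          by (auto intro!: derivative_eq_intros)
        then have "(\<lambda>i. (exp (- (t + X i) * T y) - exp (- t * T y)) / X i) \<longlonglongrightarrow> exp (- t * T y) * - T y"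
          unfolding DERIV_def tendsto_at_iff_sequentially comp_def using X0 X by blast
        then show "(\<lambda>i. (exp (- (t + X i) * T y) - exp (- t * T y)) / X i * v y) \<longlonglongrightarrow> - T y * exp (- t * T y) * v y"
          by (auto dest: tendsto_mult[OF _ tendsto_const[of "v y"]] simp: mult_ac)
      qed
      show "AE y in M. norm ((exp (- (t + X i) * T y) - exp (- t * T y)) / X i * v y) \<le> B * exp L * \<bar>v y\<bar>" for i
      proof (rule AE_I2)
        fix y
        have "\<bar>exp (- (t + X i) * T y) - exp (- t * T y)\<bar> \<le> \<bar>- (t + X i) * T y - - t * T y\<bar> * exp L"
          using K[of i] K0 by (intro abs_exp_diff_le le) auto
        also have "- (t + X i) * T y - - t * T y = - (X i * T y)"
          by (simp add: algebra_simps)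
        also have "\<bar>- (X i * T y)\<bar> * exp L \<le> \<bar>X i\<bar> * (B * exp L)"
          using T[of y] by (auto simp: abs_mult mult.assoc intro!: mult_mono)
        finally have "\<bar>exp (- (t + X i) * T y) - exp (- t * T y)\<bar> / \<bar>X i\<bar> \<le> B * exp L"
          using X0'[of i] by (simp add: field_simps)
        then show "norm ((exp (- (t + X i) * T y) - exp (- t * T y)) / X i * v y) \<le> B * exp L * \<bar>v y\<bar>"
          unfolding real_norm_def abs_mult abs_divide by (intro mult_right_mono) auto
      qed
    qed (use v in auto)
    moreover have "(\<integral>y. (exp (- (t + X i) * T y) - exp (- t * T y)) / X i * v y \<partial>M)
      = ((\<integral>y. exp (- (t + X i) * T y) * v y \<partial>M) - (\<integral>y. exp (- t * T y) * v y \<partial>M)) / X i" for i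
    proof -
      have "(\<integral>y. (exp (- (t + X i) * T y) - exp (- t * T y)) / X i * v y \<partial>M)
        = (\<integral>y. (exp (- (t + X i) * T y) * v y - exp (- t * T y) * v y) / X i \<partial>M)"
        by (intro Bochner_Integration.integral_cong refl) (simp add: algebra_simps diff_divide_distrib)
      also have "\<dots> = (\<integral>y. exp (- (t + X i) * T y) * v y - exp (- t * T y) * v y \<partial>M) / X i"
        by (rule integral_divide_zero)
      also have "(\<integral>y. exp (- (t + X i) * T y) * v y - exp (- t * T y) * v y \<partial>M)
         = (\<integral>y. exp (- (t + X i) * T y) * v y \<partial>M) - (\<integral>y. exp (- t * T y) * v y \<partial>M)"
        by (intro Bochner_Integration.integral_diff int)
      finally show ?thesis .
    qed
    ultimately show "(\<lambda>i. ((\<integral>y. exp (- (t + X i) * T y) * v y \<partial>M) - (\<integral>y. exp (- t * T y) * v y \<partial>M)) / X i)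
        \<longlonglongrightarrow> (\<integral>y. - T y * exp (- t * T y) * v y \<partial>M)"
      by (simp only:)
  qed
qed

text \<open>Each derivative brings down a factor \<open>- T\<close>; as \<open>T\<close> and, almost
  everywhere, \<open>w\<close> are nonnegative, the \<open>k\<close>-th derivative has the sign
  \<open>(-1) ^ k\<close>.\<close>

lemma completely_monotone_laplace:
  fixes w T :: "'y \<Rightarrow> real"
  assumes w: "integrable M w" "AE y in M. 0 \<le> w y" and T_meas[measurable]: "T \<in> borel_measurable M"
    and T: "\<And>y. 0 \<le> T y" "\<And>y. T y \<le> B"
  shows "completely_monotone (\<lambda>t. \<integral>y. exp (- t * T y) * w y \<partial>M)"
proof -
  \<comment> \<open>The powers of \<open>- T\<close> are put into the weight so that the derivative
    lemma applies unchanged at every order.\<close>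
  define F where "F k t = (\<integral>y. exp (- t * T y) * ((- T y) ^ k * w y) \<partial>M)" for k t
  have i: "integrable M (\<lambda>y. (- T y) ^ k * w y)" for k
  proof (rule Bochner_Integration.integrable_bound[OF integrable_mult_right[OF w(1), of "B ^ k"]])
    have "0 \<le> B" using T[of undefined] by linarith
    then show "AE y in M. norm ((- T y) ^ k * w y) \<le> norm (B ^ k * w y)"
      using T by (auto simp: abs_mult power_abs intro!: mult_right_mono power_mono)
  qed (use w in auto)
  have D: "(F k has_real_derivative F (Suc k) t) (at t)" for k t
  proof -
    have "F (Suc k) t = (\<integral>y. - T y * exp (- t * T y) * ((- T y) ^ k * w y) \<partial>M)"
      unfolding F_def by (intro Bochner_Integration.integral_cong refl) (simp add: mult_ac)
    then show ?thesis
      unfolding F_def[abs_def] using laplace_has_derivative[OF i T_meas T] by simp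
  qed
  have deriv: "(deriv ^^ k) (F 0) = F k" for k
    by (induction k) (auto intro!: ext DERIV_imp_deriv D)
  have F0: "(\<lambda>t. \<integral>y. exp (- t * T y) * w y \<partial>M) = F 0"
    by (simp add: F_def fun_eq_iff)
  have sgn: "0 \<le> (-1) ^ k * F k t" for k t
  proof -
    have "(-1) ^ k * F k t = (\<integral>y. (-1) ^ k * (exp (- t * T y) * ((- T y) ^ k * w y)) \<partial>M)"
      unfolding F_def by simp
    also have "\<dots> = (\<integral>y. exp (- t * T y) * (T y ^ k * w y) \<partial>M)"
    proof (rule Bochner_Integration.integral_cong[OF refl])
      fix y
      have "(-1) ^ k * (exp (- t * T y) * ((- T y) ^ k * w y)) = exp (- t * T y) * (((-1) ^ k * (- T y) ^ k) * w y)"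
        by (simp only: mult_ac)
      also have "(-1) ^ k * (- T y) ^ k = T y ^ k"
        by (simp flip: power_mult_distrib)
      finally show "(-1) ^ k * (exp (- t * T y) * ((- T y) ^ k * w y)) = exp (- t * T y) * (T y ^ k * w y)" .
    qed
    also have "\<dots> \<ge> 0"
      using w(2) T(1) by (intro integral_nonneg_AE) (auto elim!: eventually_mono)
    finally show ?thesis .
  qed
  show ?thesis
    unfolding completely_monotone_def F0 deriv
    using D sgn by (auto simp: real_differentiable_def)
qed

section \<open>The extension operator as a Laplace transform\<close>

lemma
  fixes a :: "'a::euclidean_space \<Rightarrow> complex" and b :: "'b::euclidean_space \<Rightarrow> complex"
  assumes a: "integrable lborel a" and b: "integrable lborel b"
  shows integrable_pair_mult: "integrable (lborel \<Otimes>\<^sub>M lborel) (\<lambda>(x, y). a x * b y)"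
    and integral_pair_mult: "(\<integral>(x, y). a x * b y \<partial>(lborel \<Otimes>\<^sub>M lborel)) = (\<integral>x. a x \<partial>lborel) * (\<integral>y. b y \<partial>lborel)"
proof -
  have [measurable]: "a \<in> borel_measurable borel" "b \<in> borel_measurable borel"
    using a b by (auto dest: borel_measurable_integrable)
  show i: "integrable (lborel \<Otimes>\<^sub>M lborel) (\<lambda>(x, y). a x * b y)"
  proof (rule lborel_pair.Fubini_integrable)
    show "integrable lborel (\<lambda>x. \<integral>y. norm (case (x, y) of (x, y) \<Rightarrow> a x * b y) \<partial>lborel)"
      using a by (simp add: norm_mult)
  qed (use b in auto)
  have "(\<integral>(x, y). a x * b y \<partial>(lborel \<Otimes>\<^sub>M lborel)) = (\<integral>x. (\<integral>y. a x * b y \<partial>lborel) \<partial>lborel)"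
    by (rule lborel_pair.integral_fst[symmetric]) (rule i)
  also have "\<dots> = (\<integral>x. a x \<partial>lborel) * (\<integral>y. b y \<partial>lborel)"
    by simp
  finally show "(\<integral>(x, y). a x * b y \<partial>(lborel \<Otimes>\<^sub>M lborel)) = (\<integral>x. a x \<partial>lborel) * (\<integral>y. b y \<partial>lborel)" .
qed

lemma integrable_bounded_mult:
  fixes f u :: "'z \<Rightarrow> 'b::{real_normed_field,banach,second_countable_topology}"
  assumes f: "integrable N f" and u: "u \<in> borel_measurable N" "\<And>x. norm (u x) \<le> L"
  shows "integrable N (\<lambda>x. u x * f x)"
proof (rule Bochner_Integration.integrable_bound)
  show "integrable N (\<lambda>x. L * norm (f x))"
    by (intro integrable_mult_right integrable_norm f)
  show "AE x in N. norm (u x * f x) \<le> norm (L * norm (f x))"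
  proof (rule AE_I2)
    fix x
    have "norm (u x * f x) \<le> L * norm (f x)"
      unfolding norm_mult by (intro mult_right_mono u) simp
    also have "\<dots> \<le> norm (L * norm (f x))" by simp
    finally show "norm (u x * f x) \<le> norm (L * norm (f x))" .
  qed
qed (use borel_measurable_integrable[OF f] u(1) in measurable)

text \<open>The analytic core, for Borel functions on the whole space: \<open>h\<close> stands for
  \<open>g\<close> cut off to \<open>U\<close>, and \<open>P\<close> for \<open>\<phi>\<close>. The
  weight is \<open>w = K * (C * m - |f|^2)\<close>; the exponent is twice the last coordinate
  because \<open>|f|^2\<close> and \<open>m\<close> are both quadratic in
  \<open>h(\<xi>) h(\<eta>)\<close>.\<close>

lemma extension_laplace_representation:
  fixes h :: "'a::euclidean_space \<Rightarrow> complex" and P :: "'a \<Rightarrow> real"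
  assumes h1: "integrable lborel h" and h2: "integrable lborel (\<lambda>\<xi>. (norm (h \<xi>))\<^sup>2)"
    and off: "\<And>\<xi>. \<xi> \<notin> U \<Longrightarrow> h \<xi> = 0"
    and U[measurable]: "U \<in> sets borel" and fin: "emeasure lborel U < \<infinity>"
    and P[measurable]: "P \<in> borel_measurable borel" and PB: "\<And>\<xi>. 0 \<le> P \<xi>" "\<And>\<xi>. P \<xi> \<le> B"
    and C: "0 < C"
    and dom: "\<And>E. E \<in> sets borel \<Longrightarrow>
      emeasure (lborel \<Otimes>\<^sub>M lborel) {(\<xi>, \<eta>). \<xi> \<in> U \<and> \<eta> \<in> U \<and> (\<xi> + \<eta>, P \<xi> + P \<eta>) \<in> E} \<le> ennreal C * emeasure lborel E"
  defines "ext \<equiv> \<lambda>t (x, s). \<integral>\<xi>. complex_of_real (exp (- t * P \<xi>)) * h \<xi> * cis (s * P \<xi> + x \<bullet> \<xi>) \<partial>lborel"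
    and "K \<equiv> (2 * pi) ^ DIM('a \<times> real)"
  shows "\<exists>w T :: 'a \<times> real \<Rightarrow> real. integrable lborel w \<and> (AE y in lborel. 0 \<le> w y)
    \<and> T \<in> borel_measurable lborel \<and> (\<forall>y. 0 \<le> T y \<and> T y \<le> 4 * B)
    \<and> (\<forall>t. integrable lborel (\<lambda>p. (norm (ext t p)) ^ 4))
    \<and> (\<forall>t. K * C * (\<integral>\<xi>. (norm (complex_of_real (exp (- t * P \<xi>)) * h \<xi>))\<^sup>2 \<partial>lborel)\<^sup>2 - (\<integral>p. (norm (ext t p)) ^ 4 \<partial>lborel)
       = (\<integral>y. exp (- t * T y) * w y \<partial>lborel))"
proof -
  have [measurable]: "h \<in> borel_measurable borel"
    using h1 by (auto dest: borel_measurable_integrable)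
  have B0: "0 \<le> B" using PB[of 0] by linarith
  define H where "H = (\<lambda>(\<xi>, \<eta>). h \<xi> * h \<eta>)"
  define \<Psi> where "\<Psi> = (\<lambda>(\<xi>, \<eta>). (\<xi> + \<eta>, P \<xi> + P \<eta>))"
  define M where "M = density (lborel \<Otimes>\<^sub>M lborel) (\<lambda>z :: 'a \<times> 'a. ennreal (indicator (U \<times> U) z))"
  have UU[measurable]: "U \<times> U \<in> sets (borel \<Otimes>\<^sub>M borel)" by measurable
  have sM[measurable_cong]: "sets M = sets (borel \<Otimes>\<^sub>M borel)"
    unfolding M_def by (simp cong: sets_pair_measure_cong)
  have \<Psi>m[measurable]: "\<Psi> \<in> borel_measurable M"
  proof -
    have "\<Psi> \<in> measurable (borel \<Otimes>\<^sub>M borel) (borel \<Otimes>\<^sub>M borel)"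
      unfolding \<Psi>_def by measurable
    moreover have "borel_measurable M = measurable (borel \<Otimes>\<^sub>M borel) (borel \<Otimes>\<^sub>M borel :: ('a \<times> real) measure)"
      by (rule measurable_cong_sets[OF sM]) (simp only: borel_prod)
    ultimately show ?thesis by blast
  qed
  have Hm[measurable]: "H \<in> borel_measurable (borel \<Otimes>\<^sub>M borel)"
    unfolding H_def by measurable
  have spM: "space M = UNIV" by (simp add: M_def space_pair_measure)
  have emM: "emeasure M A = emeasure (lborel \<Otimes>\<^sub>M lborel) (U \<times> U \<inter> A)" if A: "A \<in> sets M" for A
  proof -
    have A'[measurable]: "A \<in> sets (borel \<Otimes>\<^sub>M borel)" using A by (simp add: sM)
    have "emeasure M A = (\<integral>\<^sup>+z. ennreal (indicator (U \<times> U) z) * indicator A z \<partial>(lborel \<Otimes>\<^sub>M lborel))"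
      unfolding M_def by (rule emeasure_density) (use A in \<open>auto simp: M_def\<close>)
    also have "\<dots> = (\<integral>\<^sup>+z. indicator (U \<times> U \<inter> A) z \<partial>(lborel \<Otimes>\<^sub>M lborel))"
      by (intro nn_integral_cong) (auto split: split_indicator)
    also have "\<dots> = emeasure (lborel \<Otimes>\<^sub>M lborel) (U \<times> U \<inter> A)"
      by (intro nn_integral_indicator) measurable
    finally show ?thesis .
  qed
  \<comment> \<open>\<open>H\<close> vanishes off \<open>U \<times> U\<close>, so integrals
    containing it as a factor do not see the restriction to that set.\<close>
  have intM: "(\<integral>z. g z \<partial>M) = (\<integral>z. g z \<partial>(lborel \<Otimes>\<^sub>M lborel))"
    if g[measurable]: "g \<in> borel_measurable (borel \<Otimes>\<^sub>M borel)" and g0: "\<And>z. H z = 0 \<Longrightarrow> g z = 0" for g :: "'a \<times> 'a \<Rightarrow> complex"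
  proof -
    have "indicator (U \<times> U) z *\<^sub>R g z = g z" for z
      using g0[of z] off by (cases z) (auto simp: H_def split: split_indicator)
    then show ?thesis
      unfolding M_def by (subst integral_density) auto
  qed
  have integrableM: "integrable M g"
    if g: "integrable (lborel \<Otimes>\<^sub>M lborel) g" for g :: "'a \<times> 'a \<Rightarrow> complex"
  proof -
    have [measurable]: "g \<in> borel_measurable (borel \<Otimes>\<^sub>M borel)"
      using borel_measurable_integrable[OF g] by simp
    have "integrable (lborel \<Otimes>\<^sub>M lborel) (\<lambda>z. indicator (U \<times> U) z *\<^sub>R g z)"
      by (rule Bochner_Integration.integrable_bound[OF g]) (auto split: split_indicator)
    then show ?thesis
      unfolding M_def by (subst integrable_density) auto
  qed
  have "finite_measure M"
  proof (rule finite_measureI)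
    have "emeasure M (space M) = emeasure (lborel \<Otimes>\<^sub>M lborel) (U \<times> U \<inter> space M)"
      by (rule emM) simp
    also have "\<dots> = emeasure lborel U * emeasure lborel U"
      by (simp add: spM lborel.emeasure_pair_measure_Times)
    also have "\<dots> < \<infinity>" using fin by (simp add: ennreal_mult_less_top)
    finally show "emeasure M (space M) \<noteq> \<infinity>" by simp
  qed
  then interpret M: dominated_pushforward M \<Psi> C
  proof (rule dominated_pushforward.intro[OF _ dominated_pushforward_axioms.intro[OF \<Psi>m C]])
    fix E :: "('a \<times> real) set" assume E[measurable]: "E \<in> sets borel"
    have "emeasure M (\<Psi> -` E \<inter> space M) = emeasure (lborel \<Otimes>\<^sub>M lborel) (U \<times> U \<inter> (\<Psi> -` E \<inter> space M))"
      by (rule emM) (rule measurable_sets[OF \<Psi>m E])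
    also have "U \<times> U \<inter> (\<Psi> -` E \<inter> space M) = {(\<xi>, \<eta>). \<xi> \<in> U \<and> \<eta> \<in> U \<and> (\<xi> + \<eta>, P \<xi> + P \<eta>) \<in> E}"
      by (auto simp: \<Psi>_def spM)
    finally show "emeasure M (\<Psi> -` E \<inter> space M) \<le> ennreal C * emeasure lborel E"
      using dom[OF E] by simp
  qed
  have iH: "integrable M H"
    unfolding H_def by (intro integrableM integrable_pair_mult h1)
  have iH2: "integrable M (\<lambda>z. (norm (H z))\<^sup>2)"
  proof -
    have "integrable lborel (\<lambda>\<xi>. complex_of_real ((norm (h \<xi>))\<^sup>2))"
      by (rule integrable_of_real[OF h2])
    then have "integrable M (\<lambda>(\<xi>, \<eta>). complex_of_real ((norm (h \<xi>))\<^sup>2) * complex_of_real ((norm (h \<eta>))\<^sup>2))"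
      by (intro integrableM integrable_pair_mult)
    moreover have "(\<lambda>(\<xi>, \<eta>). complex_of_real ((norm (h \<xi>))\<^sup>2) * complex_of_real ((norm (h \<eta>))\<^sup>2))
        = (\<lambda>z. complex_of_real ((norm (H z))\<^sup>2))"
      by (auto simp: fun_eq_iff H_def norm_mult power_mult_distrib)
    ultimately have "integrable M (\<lambda>z. complex_of_real ((norm (H z))\<^sup>2))"
      by (simp only:)
    from integrable_Re[OF this] show ?thesis by simp
  qed
  obtain f where f: "integrable lborel f"
    "\<And>k B. k \<in> borel_measurable borel \<Longrightarrow> (\<And>y. norm (k y) \<le> B) \<Longrightarrow> (\<integral>z. H z * k (\<Psi> z) \<partial>M) = (\<integral>y. f y * k y \<partial>lborel)"
    using M.density_exists[OF iH] by blast
  obtain m :: "'a \<times> real \<Rightarrow> real" where m: "integrable lborel m"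
    "\<And>k :: 'a \<times> real \<Rightarrow> complex. k \<in> borel_measurable borel \<Longrightarrow>
      (\<integral>z. complex_of_real ((norm (H z))\<^sup>2) * k (\<Psi> z) \<partial>M) = (\<integral>y. complex_of_real (m y) * k y \<partial>lborel)"
    using M.density_exists_nonneg[OF iH2] by auto
  have fm: "AE y in lborel. (norm (f y))\<^sup>2 \<le> C * m y"
    by (rule M.AE_density_square_le[OF iH iH2 f m])
  have [measurable]: "f \<in> borel_measurable borel" "m \<in> borel_measurable borel"
    using f(1) m(1) by (auto dest: borel_measurable_integrable)
  have f2: "integrable lborel (\<lambda>y. (norm (f y))\<^sup>2)"
    by (rule Bochner_Integration.integrable_bound[OF integrable_mult_right[OF m(1), of C]])
       (use fm in \<open>auto elim!: eventually_mono\<close>)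
  \<comment> \<open>Clamping the last coordinate to \<open>[0, 2 * B]\<close> changes nothing on the
    image of \<open>\<Psi>\<close> but makes the exponential weights bounded on the whole
    space.\<close>
  define \<tau> where "\<tau> y = max 0 (min (2 * B) (snd y))" for y :: "'a \<times> real"
  have \<tau>: "0 \<le> \<tau> y" "\<tau> y \<le> 2 * B" for y using B0 by (auto simp: \<tau>_def)
  have [measurable]: "\<tau> \<in> borel_measurable borel"
    unfolding \<tau>_def[abs_def] by (intro borel_measurable_max borel_measurable_min borel_measurable_const
      borel_measurable_continuous_onI continuous_intros)
  have \<tau>\<Psi>: "\<tau> (\<Psi> (\<xi>, \<eta>)) = P \<xi> + P \<eta>" for \<xi> \<eta>
    using PB[of \<xi>] PB[of \<eta>] by (auto simp: \<tau>_def \<Psi>_def)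
  define w where "w y = K * (C * m y - (norm (f y))\<^sup>2)" for y
  have K0: "0 < K" by (simp add: K_def)
  define g where "g t y = f y * complex_of_real (exp (- t * \<tau> y))" for t y
  have [measurable]: "g t \<in> borel_measurable borel" for t unfolding g_def by measurable
  have exp_le: "exp (- t * \<tau> y) \<le> exp (\<bar>t\<bar> * (2 * B))" for t y
    using mult_mono[of "- t" "\<bar>t\<bar>" "\<tau> y" "2 * B"] \<tau>[of y] by auto
  have g1: "integrable lborel (g t)" for t
  proof -
    have "integrable lborel (\<lambda>y. complex_of_real (exp (- t * \<tau> y)) * f y)"
      by (rule integrable_bounded_mult[OF f(1), where L="exp (\<bar>t\<bar> * (2 * B))"]) (use exp_le[of t] in auto)
    then show ?thesis
      unfolding g_def by (simp only: mult.commute)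
  qed
  have g_sq: "(norm (g t y))\<^sup>2 = exp (- t * (2 * \<tau> y)) * (norm (f y))\<^sup>2" for t y
    by (simp add: g_def norm_mult power_mult_distrib exp_double[symmetric] mult_ac)
  have exp_bound: "integrable lborel (\<lambda>y. exp (- t * (2 * \<tau> y)) * v y)" if v: "integrable lborel v" for t and v :: "'a \<times> real \<Rightarrow> real"
  proof (rule integrable_bounded_mult[OF v, where L="exp (\<bar>2 * t\<bar> * (2 * B))"])
    show "norm (exp (- t * (2 * \<tau> y))) \<le> exp (\<bar>2 * t\<bar> * (2 * B))" for y
      using exp_le[of "2 * t" y] by (simp add: mult_ac)
  qed measurable
  have g2: "integrable lborel (\<lambda>y. (norm (g t y))\<^sup>2)" for t
    unfolding g_sq by (rule exp_bound[OF f2])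
  \<comment> \<open>Phase and weight of \<open>a \<xi> * a \<eta>\<close> are functions of
    \<open>\<Psi> (\<xi>, \<eta>)\<close>, so the squared integral becomes a Fourier transform on
    the image space, with \<open>f\<close> reweighted to \<open>g t\<close>.\<close>
  have ext_sq: "(ext t p)\<^sup>2 = fourier (g t) p" for t p
  proof -
    obtain x s where p: "p = (x, s)" by (cases p)
    define a where "a \<xi> = complex_of_real (exp (- t * P \<xi>)) * h \<xi> * cis (s * P \<xi> + x \<bullet> \<xi>)" for \<xi>
    have [measurable]: "a \<in> borel_measurable borel" unfolding a_def by measurable
    have expP: "exp (- t * P \<xi>) \<le> exp (\<bar>t\<bar> * B)" for \<xi>
      using mult_mono[of "- t" "\<bar>t\<bar>" "P \<xi>" B] PB[of \<xi>] by auto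
    have ia: "integrable lborel a"
    proof -
      have "integrable lborel (\<lambda>\<xi>. (complex_of_real (exp (- t * P \<xi>)) * cis (s * P \<xi> + x \<bullet> \<xi>)) * h \<xi>)"
        by (rule integrable_bounded_mult[OF h1, where L="exp (\<bar>t\<bar> * B)"]) (use expP in \<open>auto simp: norm_mult\<close>)
      then show ?thesis unfolding a_def by (simp only: mult_ac)
    qed
    define k where "k y = complex_of_real (exp (- t * \<tau> y)) * cis (p \<bullet> y)" for y
    have [measurable]: "k \<in> borel_measurable borel" unfolding k_def by measurable
    have k\<Psi>: "(\<lambda>z. k (\<Psi> z)) \<in> borel_measurable (borel \<Otimes>\<^sub>M borel)"
      using measurable_compose[OF \<Psi>m, of k borel] by (simp cong: measurable_cong_sets add: sM)
    have ak: "a \<xi> * a \<eta> = H (\<xi>, \<eta>) * k (\<Psi> (\<xi>, \<eta>))" for \<xi> \<eta>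
    proof -
      have "cis (p \<bullet> \<Psi> (\<xi>, \<eta>)) = cis (s * P \<xi> + x \<bullet> \<xi>) * cis (s * P \<eta> + x \<bullet> \<eta>)"
        by (simp add: cis_mult p \<Psi>_def inner_add_right algebra_simps)
      moreover have "complex_of_real (exp (- t * \<tau> (\<Psi> (\<xi>, \<eta>)))) = complex_of_real (exp (- t * P \<xi>)) * complex_of_real (exp (- t * P \<eta>))"
        unfolding \<tau>\<Psi> by (simp add: distrib_left exp_add exp_diff exp_minus divide_inverse)
      ultimately show ?thesis
        unfolding a_def k_def H_def by (simp only: prod.case mult_ac)
    qed
    have "(ext t p)\<^sup>2 = (\<integral>\<xi>. a \<xi> \<partial>lborel) * (\<integral>\<xi>. a \<xi> \<partial>lborel)"
      by (simp add: ext_def p a_def power2_eq_square)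
    also have "\<dots> = (\<integral>(\<xi>, \<eta>). a \<xi> * a \<eta> \<partial>(lborel \<Otimes>\<^sub>M lborel))"
      by (rule integral_pair_mult[OF ia ia, symmetric])
    also have "\<dots> = (\<integral>z. H z * k (\<Psi> z) \<partial>(lborel \<Otimes>\<^sub>M lborel))"
      by (intro Bochner_Integration.integral_cong refl) (auto simp: ak)
    also have "\<dots> = (\<integral>z. H z * k (\<Psi> z) \<partial>M)"
      using k\<Psi> by (intro intM[symmetric]) auto
    also have "\<dots> = (\<integral>y. f y * k y \<partial>lborel)"
      by (rule f(2)[of _ "exp (\<bar>t\<bar> * (2 * B))"]) (use exp_le[of t] in \<open>auto simp: k_def norm_mult\<close>)
    also have "\<dots> = fourier (g t) p"
      unfolding fourier_def g_def k_def by (simp only: mult.assoc)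
    finally show ?thesis .
  qed
  have ext4: "(norm (ext t p)) ^ 4 = (norm (fourier (g t) p))\<^sup>2" for t p
    unfolding ext_sq[symmetric] norm_power by (simp flip: power_mult)
  have i4: "integrable lborel (\<lambda>p. (norm (ext t p)) ^ 4)" for t
    unfolding ext4 by (rule plancherel(1)[OF g1 g2])
  have v4: "(\<integral>p. (norm (ext t p)) ^ 4 \<partial>lborel) = K * (\<integral>y. exp (- t * (2 * \<tau> y)) * (norm (f y))\<^sup>2 \<partial>lborel)" for t
    unfolding ext4 plancherel(2)[OF g1 g2] K_def g_sq ..
  \<comment> \<open>The same device for \<open>|H|^2\<close>: the fourth power of the L2 norm is a
    double integral, transported to the density \<open>m\<close> with the squared weight.\<close>
  have norm4: "(\<integral>\<xi>. (norm (complex_of_real (exp (- t * P \<xi>)) * h \<xi>))\<^sup>2 \<partial>lborel)\<^sup>2 = (\<integral>y. exp (- t * (2 * \<tau> y)) * m y \<partial>lborel)" for t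
  proof -
    define b where "b \<xi> = complex_of_real ((norm (complex_of_real (exp (- t * P \<xi>)) * h \<xi>))\<^sup>2)" for \<xi>
    have b: "b \<xi> = complex_of_real ((exp (- t * P \<xi>))\<^sup>2 * (norm (h \<xi>))\<^sup>2)" for \<xi>
      by (simp add: b_def norm_mult power_mult_distrib)
    have [measurable]: "b \<in> borel_measurable borel" unfolding b_def by measurable
    have expP: "(exp (- t * P \<xi>))\<^sup>2 \<le> (exp (\<bar>t\<bar> * B))\<^sup>2" for \<xi>
      using mult_mono[of "- t" "\<bar>t\<bar>" "P \<xi>" B] PB[of \<xi>] by (intro power_mono) auto
    have ib: "integrable lborel b"
    proof -
      have "integrable lborel (\<lambda>\<xi>. (exp (- t * P \<xi>))\<^sup>2 * (norm (h \<xi>))\<^sup>2)"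
        by (rule integrable_bounded_mult[OF h2, where L="(exp (\<bar>t\<bar> * B))\<^sup>2"]) (use expP in auto)
      from integrable_of_real[OF this] show ?thesis unfolding b .
    qed
    define k where "k y = complex_of_real (exp (- t * (2 * \<tau> y)))" for y
    have [measurable]: "k \<in> borel_measurable borel" unfolding k_def by measurable
    have k\<Psi>: "(\<lambda>z. k (\<Psi> z)) \<in> borel_measurable (borel \<Otimes>\<^sub>M borel)"
      using measurable_compose[OF \<Psi>m, of k borel] by (simp cong: measurable_cong_sets add: sM)
    have bk: "b \<xi> * b \<eta> = complex_of_real ((norm (H (\<xi>, \<eta>)))\<^sup>2) * k (\<Psi> (\<xi>, \<eta>))" for \<xi> \<eta>
    proof -
      have "exp (- t * (2 * \<tau> (\<Psi> (\<xi>, \<eta>)))) = (exp (- t * P \<xi>))\<^sup>2 * (exp (- t * P \<eta>))\<^sup>2"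
        unfolding \<tau>\<Psi> by (simp add: exp_double[symmetric] exp_add[symmetric] algebra_simps)
      then show ?thesis
        unfolding b k_def H_def by (simp add: norm_mult power_mult_distrib)
    qed
    have "complex_of_real ((\<integral>\<xi>. (norm (complex_of_real (exp (- t * P \<xi>)) * h \<xi>))\<^sup>2 \<partial>lborel)\<^sup>2) = (\<integral>\<xi>. b \<xi> \<partial>lborel) * (\<integral>\<xi>. b \<xi> \<partial>lborel)"
      unfolding b_def integral_complex_of_real by (simp add: power2_eq_square)
    also have "\<dots> = (\<integral>(\<xi>, \<eta>). b \<xi> * b \<eta> \<partial>(lborel \<Otimes>\<^sub>M lborel))"
      by (rule integral_pair_mult[OF ib ib, symmetric])
    also have "\<dots> = (\<integral>z. complex_of_real ((norm (H z))\<^sup>2) * k (\<Psi> z) \<partial>(lborel \<Otimes>\<^sub>M lborel))"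
      by (intro Bochner_Integration.integral_cong refl) (auto simp: bk)
    also have "\<dots> = (\<integral>z. complex_of_real ((norm (H z))\<^sup>2) * k (\<Psi> z) \<partial>M)"
      using k\<Psi> by (intro intM[symmetric]) auto
    also have "\<dots> = (\<integral>y. complex_of_real (m y) * k y \<partial>lborel)"
      by (rule m(2)) simp
    also have "\<dots> = (\<integral>y. complex_of_real (exp (- t * (2 * \<tau> y)) * m y) \<partial>lborel)"
      by (intro Bochner_Integration.integral_cong refl) (simp add: k_def)
    also have "\<dots> = complex_of_real (\<integral>y. exp (- t * (2 * \<tau> y)) * m y \<partial>lborel)"
      by (rule integral_complex_of_real)
    finally show ?thesis by (simp only: of_real_eq_iff)
  qed
  show ?thesis
  proof (rule exI[of _ w], rule exI[of _ "\<lambda>y. 2 * \<tau> y"], intro conjI allI)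
    show "integrable lborel w"
      unfolding w_def using m(1) f2 by (intro integrable_mult_right Bochner_Integration.integrable_diff)
    show "AE y in lborel. 0 \<le> w y"
      using fm by eventually_elim (use K0 in \<open>simp add: w_def\<close>)
    show "(\<lambda>y. 2 * \<tau> y) \<in> borel_measurable lborel" by measurable
    show "0 \<le> 2 * \<tau> y" "2 * \<tau> y \<le> 4 * B" for y using \<tau>[of y] by auto
    show "integrable lborel (\<lambda>p. (norm (ext t p)) ^ 4)" for t by (rule i4)
    show "K * C * (\<integral>\<xi>. (norm (complex_of_real (exp (- t * P \<xi>)) * h \<xi>))\<^sup>2 \<partial>lborel)\<^sup>2 - (\<integral>p. (norm (ext t p)) ^ 4 \<partial>lborel)
       = (\<integral>y. exp (- t * (2 * \<tau> y)) * w y \<partial>lborel)" for t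
    proof -
      have "(\<integral>y. exp (- t * (2 * \<tau> y)) * w y \<partial>lborel)
        = (\<integral>y. K * C * (exp (- t * (2 * \<tau> y)) * m y) - K * (exp (- t * (2 * \<tau> y)) * (norm (f y))\<^sup>2) \<partial>lborel)"
        by (intro Bochner_Integration.integral_cong refl) (simp add: w_def right_diff_distrib mult_ac)
      also have "\<dots> = (\<integral>y. K * C * (exp (- t * (2 * \<tau> y)) * m y) \<partial>lborel) - (\<integral>y. K * (exp (- t * (2 * \<tau> y)) * (norm (f y))\<^sup>2) \<partial>lborel)"
        by (intro Bochner_Integration.integral_diff integrable_mult_right exp_bound m(1) f2)
      also have "\<dots> = K * C * (\<integral>y. exp (- t * (2 * \<tau> y)) * m y \<partial>lborel) - K * (\<integral>y. exp (- t * (2 * \<tau> y)) * (norm (f y))\<^sup>2 \<partial>lborel)"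
        by (simp only: integral_mult_right_zero)
      finally show ?thesis unfolding norm4 v4 by simp
    qed
  qed
qed

section \<open>From Lebesgue to Borel measurable functions, and the conclusion\<close>

lemma completion_ex_borel_measurable_complex:
  fixes g :: "'a \<Rightarrow> complex"
  assumes "g \<in> borel_measurable (completion M)"
  obtains g' where "g' \<in> borel_measurable M" "AE x in M. g x = g' x"
proof -
  have "(\<lambda>x. Re (g x)) \<in> borel_measurable (completion M)" "(\<lambda>x. Im (g x)) \<in> borel_measurable (completion M)"
    using assms by auto
  from this[THEN completion_ex_borel_measurable_real] obtain r i
    where ri: "r \<in> borel_measurable M" "AE x in M. Re (g x) = r x" "i \<in> borel_measurable M" "AE x in M. Im (g x) = i x"
    by blast
  show ?thesis
  proof
    show "(\<lambda>x. Complex (r x) (i x)) \<in> borel_measurable M"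
      using ri(1,3) unfolding Complex_eq by measurable
    show "AE x in M. g x = Complex (r x) (i x)"
      using ri(2,4) by eventually_elim (simp add: complex_eq_iff)
  qed
qed

text \<open>Integrability of the fourth power is part of the conclusion because the Bochner integral
  of a non-integrable function is 0 by convention, which would empty the claim of its
  meaning.\<close>

theorem theorem4p1:
  fixes U V :: "(real^2) set" and \<phi> :: "real^2 \<Rightarrow> real"
  assumes "compact U" and "open V" and "U \<subseteq> V"
    and "smooth_on V \<phi>"
    and "\<forall>x\<in>V. hessian_posdef \<phi> x"
    and "\<forall>\<xi>\<in>U. \<phi> \<xi> \<ge> 0"
  shows "\<exists>c::real. \<forall>g :: real^2 \<Rightarrow> complex.
           set_borel_measurable lebesgue U g
           \<and> set_integrable lebesgue U (\<lambda>\<xi>. (norm (g \<xi>))\<^sup>2) \<longrightarrow>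
           (let gt = (\<lambda>t \<xi>. complex_of_real (exp (- t * \<phi> \<xi>)) * g \<xi>)
            in (\<forall>t>0. integrable lborel (\<lambda>p. (norm (ext_op U \<phi> (gt t) p)) ^ 4))
               \<and> completely_monotone (\<lambda>t.
                   c * (LINT \<xi>:U|lebesgue. (norm (gt t \<xi>))\<^sup>2)\<^sup>2
                   - (\<integral>p. (norm (ext_op U \<phi> (gt t) p)) ^ 4 \<partial>lborel)))"
proof -
  obtain C0 where C0: "0 \<le> C0" "\<And>\<zeta> a b. a \<le> b \<Longrightarrow>
      emeasure lborel {\<xi> \<in> U. \<zeta> - \<xi> \<in> U \<and> \<phi> \<xi> + \<phi> (\<zeta> - \<xi>) \<in> {a<..b}} \<le> ennreal (C0 * (b - a))"
    using emeasure_sum_layer[of U V \<phi>] assms by auto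
  \<comment> \<open>Adding 1 makes the density bound positive, so that it can be divided by.\<close>
  define C where "C = C0 + 1"
  have C: "0 < C" using C0 by (simp add: C_def)
  have U[measurable]: "U \<in> sets borel" using assms(1) by (rule borel_compact)
  have cont: "continuous_on U \<phi>"
    using smooth_on_continuous_on_iter_pderiv[OF assms(4), of "[]"] assms(3) by (auto intro: continuous_on_subset)
  \<comment> \<open>Nothing is known about \<open>\<phi>\<close> off \<open>V\<close>; the cutoff to
    \<open>U\<close> is Borel because \<open>\<phi>\<close> is continuous on \<open>U\<close>, and
    it is bounded on the whole plane.\<close>
  define P where "P \<xi> = indicator U \<xi> *\<^sub>R \<phi> \<xi>" for \<xi>
  have P_eq: "P \<xi> = \<phi> \<xi>" if "\<xi> \<in> U" for \<xi> using that by (simp add: P_def)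
  have P[measurable]: "P \<in> borel_measurable borel"
    unfolding P_def by (rule borel_measurable_continuous_on_indicator[OF U cont])
  obtain B where B: "\<And>\<xi>. \<xi> \<in> U \<Longrightarrow> \<bar>\<phi> \<xi>\<bar> \<le> B"
    using compact_imp_bounded[OF compact_continuous_image[OF cont assms(1)]] by (auto simp: bounded_iff)
  have PB: "0 \<le> P \<xi>" "P \<xi> \<le> \<bar>B\<bar>" for \<xi>
    using assms(6) B[of \<xi>] by (auto simp: P_def split: split_indicator)
  have layer: "emeasure lborel {\<xi> \<in> U. \<zeta> - \<xi> \<in> U \<and> P \<xi> + P (\<zeta> - \<xi>) \<in> {a<..b}} \<le> ennreal (C * (b - a))"
    if "a \<le> b" for \<zeta> a b
  proof -
    have "{\<xi> \<in> U. \<zeta> - \<xi> \<in> U \<and> P \<xi> + P (\<zeta> - \<xi>) \<in> {a<..b}} = {\<xi> \<in> U. \<zeta> - \<xi> \<in> U \<and> \<phi> \<xi> + \<phi> (\<zeta> - \<xi>) \<in> {a<..b}}"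
      by (auto simp: P_eq)
    also have "emeasure lborel \<dots> \<le> ennreal (C0 * (b - a))" by (rule C0(2)[OF that])
    also have "\<dots> \<le> ennreal (C * (b - a))"
      using that by (intro ennreal_leI mult_right_mono) (auto simp: C_def)
    finally show ?thesis .
  qed
  note dom = emeasure_sum_pushforward_le[OF P U less_imp_le[OF C] layer]
  have fin: "emeasure lborel U < \<infinity>" by (rule emeasure_compact_finite[OF assms(1)])
  define K where "K = (2 * pi) ^ DIM((real^2) \<times> real)"
  show ?thesis
  \<comment> \<open>The Plancherel factor in three dimensions times the density bound.\<close>
  proof (intro exI[of _ "K * C"] allI impI, elim conjE)
    fix g :: "real^2 \<Rightarrow> complex"
    assume gm: "set_borel_measurable lebesgue U g" and g2: "set_integrable lebesgue U (\<lambda>\<xi>. (norm (g \<xi>))\<^sup>2)"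
    obtain h0 where h0[measurable]: "h0 \<in> borel_measurable lborel" and gh0: "AE \<xi> in lborel. indicator U \<xi> *\<^sub>R g \<xi> = h0 \<xi>"
      using completion_ex_borel_measurable_complex[of "\<lambda>\<xi>. indicator U \<xi> *\<^sub>R g \<xi>" lborel] gm
      unfolding set_borel_measurable_def by blast
    \<comment> \<open>\<open>h0\<close> agrees with the cut-off \<open>g\<close> only almost
      everywhere; the indicator makes \<open>h\<close> vanish at every point off
      \<open>U\<close>.\<close>
    define h where "h \<xi> = indicator U \<xi> *\<^sub>R h0 \<xi>" for \<xi>
    have [measurable]: "h \<in> borel_measurable borel" unfolding h_def by measurable
    have gh: "AE \<xi> in lebesgue. indicator U \<xi> *\<^sub>R g \<xi> = h \<xi>"
      using AE_completion[OF gh0] by eventually_elim (auto simp: h_def split: split_indicator)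
    have h2: "integrable lborel (\<lambda>\<xi>. (norm (h \<xi>))\<^sup>2)"
    proof -
      have "integrable lebesgue (\<lambda>\<xi>. (norm (h \<xi>))\<^sup>2)"
      proof (rule integrable_cong_AE_imp)
        show "integrable lebesgue (\<lambda>\<xi>. indicator U \<xi> *\<^sub>R (norm (g \<xi>))\<^sup>2)"
          using g2 by (simp add: set_integrable_def)
        show "(\<lambda>\<xi>. (norm (h \<xi>))\<^sup>2) \<in> borel_measurable lebesgue"
          by (intro measurable_completion) simp
        show "AE \<xi> in lebesgue. indicator U \<xi> *\<^sub>R (norm (g \<xi>))\<^sup>2 = (norm (h \<xi>))\<^sup>2"
          using gh by eventually_elim (auto split: split_indicator_asm)
      qed
      then show ?thesis by (subst (asm) integrable_completion) auto
    qed
    \<comment> \<open>On the set \<open>U\<close> of finite measure L2 embeds into L1, by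
      \<open>x \<le> 1 + x^2\<close>.\<close>
    have h1: "integrable lborel h"
    proof (rule Bochner_Integration.integrable_bound)
      show "integrable lborel (\<lambda>\<xi>. indicator U \<xi> + (norm (h \<xi>))\<^sup>2)"
        using h2 fin by (auto simp: integrable_indicator_iff)
      show "AE \<xi> in lborel. norm (h \<xi>) \<le> norm (indicator U \<xi> + (norm (h \<xi>))\<^sup>2 :: real)"
      proof (rule AE_I2)
        fix \<xi>
        have "x \<le> 1 + x\<^sup>2" for x :: real
          using mult_le_weighted_squares[of 1 1 x] by simp
        from this[of "norm (h \<xi>)"] show "norm (h \<xi>) \<le> norm (indicator U \<xi> + (norm (h \<xi>))\<^sup>2 :: real)"
          by (auto simp: h_def split: split_indicator)
      qed
    qed simp
    have off: "h \<xi> = 0" if "\<xi> \<notin> U" for \<xi> using that by (simp add: h_def)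
    define gt where "gt = (\<lambda>t \<xi>. complex_of_real (exp (- t * \<phi> \<xi>)) * g \<xi>)"
    define E where "E = (\<lambda>t (x, s). \<integral>\<xi>. complex_of_real (exp (- t * P \<xi>)) * h \<xi> * cis (s * P \<xi> + x \<bullet> \<xi>) \<partial>lborel)"
    have ext: "ext_op U \<phi> (gt t) p = E t p" for t p
    proof -
      obtain x s where p: "p = (x, s)" by (cases p)
      let ?e = "\<lambda>\<xi>. complex_of_real (exp (- t * P \<xi>)) * h \<xi> * cis (s * P \<xi> + x \<bullet> \<xi>)"
      have m: "?e \<in> borel_measurable lborel" by measurable
      have eq: "indicator U \<xi> *\<^sub>R (gt t \<xi> * cis (s * \<phi> \<xi> + x \<bullet> \<xi>))
          = complex_of_real (exp (- t * P \<xi>)) * (indicator U \<xi> *\<^sub>R g \<xi>) * cis (s * P \<xi> + x \<bullet> \<xi>)" for \<xi>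
        by (auto simp: gt_def P_eq split: split_indicator)
      have ae: "AE \<xi> in lebesgue. indicator U \<xi> *\<^sub>R (gt t \<xi> * cis (s * \<phi> \<xi> + x \<bullet> \<xi>)) = ?e \<xi>"
        unfolding eq using gh by eventually_elim simp
      have "ext_op U \<phi> (gt t) p = (\<integral>\<xi>. indicator U \<xi> *\<^sub>R (gt t \<xi> * cis (s * \<phi> \<xi> + x \<bullet> \<xi>)) \<partial>lebesgue)"
        by (simp add: ext_op_def p set_lebesgue_integral_def)
      also have "\<dots> = (\<integral>\<xi>. ?e \<xi> \<partial>lebesgue)"
      proof (rule integral_cong_AE[OF _ _ ae])
        show m': "?e \<in> borel_measurable lebesgue" by (rule measurable_completion[OF m])
        have gm': "(\<lambda>\<xi>. indicator U \<xi> *\<^sub>R g \<xi>) \<in> borel_measurable lebesgue"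
          using gm by (simp add: set_borel_measurable_def)
        have "(\<lambda>\<xi>. complex_of_real (exp (- t * P \<xi>))) \<in> borel_measurable lebesgue"
          "(\<lambda>\<xi>. cis (s * P \<xi> + x \<bullet> \<xi>)) \<in> borel_measurable lebesgue"
          by (intro measurable_completion; measurable)+
        then show "(\<lambda>\<xi>. indicator U \<xi> *\<^sub>R (gt t \<xi> * cis (s * \<phi> \<xi> + x \<bullet> \<xi>))) \<in> borel_measurable lebesgue"
          unfolding eq by (intro borel_measurable_times gm')
      qed
      also have "\<dots> = (\<integral>\<xi>. ?e \<xi> \<partial>lborel)"
        by (rule integral_completion[OF m])
      finally show ?thesis by (simp add: E_def p)
    qed
    have nrm: "(LINT \<xi>:U|lebesgue. (norm (gt t \<xi>))\<^sup>2) = (\<integral>\<xi>. (norm (complex_of_real (exp (- t * P \<xi>)) * h \<xi>))\<^sup>2 \<partial>lborel)" for t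
    proof -
      let ?e = "\<lambda>\<xi>. (norm (complex_of_real (exp (- t * P \<xi>)) * h \<xi>))\<^sup>2"
      have m: "?e \<in> borel_measurable lborel" by measurable
      have eq: "indicator U \<xi> *\<^sub>R (norm (gt t \<xi>))\<^sup>2
          = (norm (complex_of_real (exp (- t * P \<xi>)) * (indicator U \<xi> *\<^sub>R g \<xi>)))\<^sup>2" for \<xi>
        by (auto simp: gt_def P_eq split: split_indicator)
      have ae: "AE \<xi> in lebesgue. indicator U \<xi> *\<^sub>R (norm (gt t \<xi>))\<^sup>2 = ?e \<xi>"
        unfolding eq using gh by eventually_elim simp
      have "(LINT \<xi>:U|lebesgue. (norm (gt t \<xi>))\<^sup>2) = (\<integral>\<xi>. ?e \<xi> \<partial>lebesgue)"
        unfolding set_lebesgue_integral_def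
      proof (rule integral_cong_AE[OF _ _ ae])
        show "?e \<in> borel_measurable lebesgue" by (rule measurable_completion[OF m])
        have gm': "(\<lambda>\<xi>. indicator U \<xi> *\<^sub>R g \<xi>) \<in> borel_measurable lebesgue"
          using gm by (simp add: set_borel_measurable_def)
        have "(\<lambda>\<xi>. complex_of_real (exp (- t * P \<xi>))) \<in> borel_measurable lebesgue"
          by (intro measurable_completion) measurable
        then show "(\<lambda>\<xi>. indicator U \<xi> *\<^sub>R (norm (gt t \<xi>))\<^sup>2) \<in> borel_measurable lebesgue"
          unfolding eq
          by (intro borel_measurable_power measurable_compose[OF _ borel_measurable_norm] borel_measurable_times gm')
      qed
      also have "\<dots> = (\<integral>\<xi>. ?e \<xi> \<partial>lborel)"
        by (rule integral_completion[OF m])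
      finally show ?thesis .
    qed
    have "\<exists>w T :: (real^2) \<times> real \<Rightarrow> real. integrable lborel w \<and> (AE y in lborel. 0 \<le> w y)
      \<and> T \<in> borel_measurable lborel \<and> (\<forall>y. 0 \<le> T y \<and> T y \<le> 4 * \<bar>B\<bar>)
      \<and> (\<forall>t. integrable lborel (\<lambda>p. (norm (E t p)) ^ 4))
      \<and> (\<forall>t. K * C * (\<integral>\<xi>. (norm (complex_of_real (exp (- t * P \<xi>)) * h \<xi>))\<^sup>2 \<partial>lborel)\<^sup>2 - (\<integral>p. (norm (E t p)) ^ 4 \<partial>lborel)
          = (\<integral>y. exp (- t * T y) * w y \<partial>lborel))"
      unfolding E_def K_def by (rule extension_laplace_representation[OF h1 h2 off U fin P PB C dom])
    then obtain w T :: "(real^2) \<times> real \<Rightarrow> real" where w: "integrable lborel w" "AE y in lborel. 0 \<le> w y"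
      and T: "T \<in> borel_measurable lborel" "\<And>y. 0 \<le> T y" "\<And>y. T y \<le> 4 * \<bar>B\<bar>"
      and rep: "\<And>t. integrable lborel (\<lambda>p. (norm (E t p)) ^ 4)"
        "\<And>t. K * C * (\<integral>\<xi>. (norm (complex_of_real (exp (- t * P \<xi>)) * h \<xi>))\<^sup>2 \<partial>lborel)\<^sup>2 - (\<integral>p. (norm (E t p)) ^ 4 \<partial>lborel)
          = (\<integral>y. exp (- t * T y) * w y \<partial>lborel)"
      by blast
    have "completely_monotone (\<lambda>t. K * C * (LINT \<xi>:U|lebesgue. (norm (gt t \<xi>))\<^sup>2)\<^sup>2
        - (\<integral>p. (norm (ext_op U \<phi> (gt t) p)) ^ 4 \<partial>lborel))"
      unfolding ext nrm rep(2) by (rule completely_monotone_laplace[OF w T])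
    moreover have "\<forall>t>0. integrable lborel (\<lambda>p. (norm (ext_op U \<phi> (gt t) p)) ^ 4)"
      unfolding ext using rep(1) by blast
    ultimately show "let gt = (\<lambda>t \<xi>. complex_of_real (exp (- t * \<phi> \<xi>)) * g \<xi>)
            in (\<forall>t>0. integrable lborel (\<lambda>p. (norm (ext_op U \<phi> (gt t) p)) ^ 4))
               \<and> completely_monotone (\<lambda>t. K * C * (LINT \<xi>:U|lebesgue. (norm (gt t \<xi>))\<^sup>2)\<^sup>2
                   - (\<integral>p. (norm (ext_op U \<phi> (gt t) p)) ^ 4 \<partial>lborel))"
      unfolding Let_def gt_def by blast
  qed
qed

end
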